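(* Let $n,k,\ell$ be nonnegative integers satisfying $0\le k\le p-1$ and $d_n\equiv \ell \bmod (p+1)$, $0\le \ell\le p$. Then the function $\psi_{n,k}$ has at least $Z(n,k)$ zeros with odd multiplicity in the open interval $(a_k,b_k)$. In particular, it follows that $d_n=n$ for all $n\ge 0$, that is, the polynomial $Q_n$ has degree $n$, and the associated polynomial $\mathcal{Q}_d$ has exactly $d=\frac{n-\ell}{p+1}$ zeros, which are all simple and located in $(a_0,b_0)$.
   Context: Setting. Fix an integer $p\ge 1$. For $0\le j\le p-1$ let $a_j<b_j$ be real numbers with $0\le a_j<b_j$ if $j$ is even and $a_j<b_j\le 0$ if $j$ is odd, and let $\Gamma_j=\{z\in\mathbb{C}: z^{p+1}\in[a_j,b_j]\}$. Assume $\Gamma_j\cap\Gamma_{j+1}=\emptyset$ for $0\le j\le p-2$. For each $j$ let $\sigma_j$ be a positive finite Borel measure on $\Gamma_j$, invariant under rotation by the angle $2\pi/(p+1)$, with infinitely many points in its support. Nikishin system. Set $s_{k,k}=\sigma_k$ and, for $0\le k<j\le p-1$, $ds_{k,j}(z)=\Big(\int_{\Gamma_{k+1}}\frac{ds_{k+1,j}(t)}{z-t}\Big)d\sigma_k(z)$ on $\Gamma_k$; put $s_j=s_{0,j}$. Multi-orthogonal polynomials. $Q_n$ ($n\ge0$) is the monic polynomial of lowest degree satisfying $\int_{\Gamma_0}Q_n(z)z^l\,ds_j(z)=0$ for $l=0,\ldots,\lfloor\frac{n-j-1}{p}\rfloor$, $0\le j\le p-1$. Let $d_n=\deg Q_n$,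 let $\ell\in\{0,\ldots,p\}$ be the residue of $d_n$ mod $p+1$, and $d=\lfloor d_n/(p+1)\rfloor$. By symmetry, $Q_n(t)=t^\ell\mathcal{Q}_d(t^{p+1})$ for a polynomial $\mathcal{Q}_d$ of degree $d$. Functions of the second kind. $\Psi_{n,0}=Q_n$ and $\Psi_{n,k}(z)=\int_{\Gamma_{k-1}}\frac{\Psi_{n,k-1}(t)}{z-t}d\sigma_{k-1}(t)$ for $1\le k\le p$. Set $\psi_{n,0}=\mathcal{Q}_d$ and, for $1\le k\le p$, $z\in\mathbb{C}\setminus[a_{k-1},b_{k-1}]$, $\psi_{n,k}(z)=z\int_{\Gamma_{k-1}}\frac{\Psi_{n,k-1}(t)t^{k-1-\ell}}{z-t^{p+1}}d\sigma_{k-1}(t)$ if $\ell<k$, and $\psi_{n,k}(z)=\int_{\Gamma_{k-1}}\frac{\Psi_{n,k-1}(t)t^{p+k-\ell}}{z-t^{p+1}}d\sigma_{k-1}(t)$ if $k\le\ell$. Counting numbers. For $0\le j\le p-1$ let $M_j$ be the number of integers $s$ with $\lceil\frac{\ell-j}{p+1}\rceil\le s\le\lfloor\frac{n+p\ell-1-j(p+1)}{p(p+1)}\rfloor$, and $Z(n,k)=\sum_{j=k}^{p-1}M_j$ for $0\le k\le p-1$, $Z(n,p)=0$. *)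

theory Defs
  imports
    "HOL-Complex_Analysis.Complex_Analysis"
    "HOL-Computational_Algebra.Polynomial"
    "HOL-Number_Theory.Cong"
begin

definition star_set :: "nat \<Rightarrow> (nat \<Rightarrow> real) \<Rightarrow> (nat \<Rightarrow> real) \<Rightarrow> nat \<Rightarrow> complex set" where
  "star_set p a b j = {z. \<exists>x\<in>{a j..b j}. z ^ (p + 1) = complex_of_real x}"

definition measure_support :: "complex measure \<Rightarrow> complex set" where
  "measure_support M = {z. \<forall>U. open U \<and> z \<in> U \<longrightarrow> emeasure M U > 0}"

text \<open>
  A measure on a star is represented as a Borel measure on the complex plane for which the
  complement of the star is a null set; hence an integral over the star with respect to it is
  just the Lebesgue integral with respect to \<open>\<sigma> j\<close>.
\<close>

definition star_system ::
  "nat \<Rightarrow> (nat \<Rightarrow> real) \<Rightarrow> (nat \<Rightarrow> real) \<Rightarrow> (nat \<Rightarrow> complex measure) \<Rightarrow> bool" where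
  "star_system p a b \<sigma> \<longleftrightarrow>
     p \<ge> 1 \<and>
     (\<forall>j<p. if even j then 0 \<le> a j \<and> a j < b j else a j < b j \<and> b j \<le> 0) \<and>
     (\<forall>j. j + 1 < p \<longrightarrow> star_set p a b j \<inter> star_set p a b (j + 1) = {}) \<and>
     (\<forall>j<p. sets (\<sigma> j) = sets borel \<and>
            finite_measure (\<sigma> j) \<and>
            emeasure (\<sigma> j) (- star_set p a b j) = 0 \<and>
            distr (\<sigma> j) borel (\<lambda>z. cis (2 * pi / (real p + 1)) * z) = \<sigma> j \<and>
            infinite (measure_support (\<sigma> j)))"

text \<open>
  The (complex) measure \<open>s\<^bsub>k,j\<^esub>\<close> (for \<open>k \<le> j\<close>) is represented by its density with respect to the
  positive measure \<open>\<sigma> k\<close>: the density is 1 for \<open>k = j\<close>, and for \<open>k < j\<close> it is the Cauchy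
  transform of \<open>s\<^bsub>k+1,j\<^esub>\<close>. Accordingly, the integral of \<open>f\<close> with respect to \<open>s\<^bsub>k,j\<^esub>\<close> is the
  integral of \<open>f\<close> times the density with respect to \<open>\<sigma> k\<close>.
\<close>

function nikishin_density :: "(nat \<Rightarrow> complex measure) \<Rightarrow> nat \<Rightarrow> nat \<Rightarrow> complex \<Rightarrow> complex" where
  "nikishin_density \<sigma> k j z =
     (if k < j then (LINT t|\<sigma> (Suc k). nikishin_density \<sigma> (Suc k) j t / (z - t)) else 1)"
  by pat_completeness auto
termination by (relation "Wellfounded.measure (\<lambda>(\<sigma>, k, j, z). j - k)") auto

declare nikishin_density.simps [simp del]

definition nikishin_integral ::
  "(nat \<Rightarrow> complex measure) \<Rightarrow> nat \<Rightarrow> nat \<Rightarrow> (complex \<Rightarrow> complex) \<Rightarrow> complex" where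
  "nikishin_integral \<sigma> k j f = (LINT z|\<sigma> k. f z * nikishin_density \<sigma> k j z)"

text \<open>The upper limit for \<open>l\<close> may be \<open>-1\<close>, in which case there is no condition for that \<open>j\<close>.\<close>

definition multi_orthogonal ::
  "nat \<Rightarrow> (nat \<Rightarrow> complex measure) \<Rightarrow> nat \<Rightarrow> complex poly \<Rightarrow> bool" where
  "multi_orthogonal p \<sigma> n P \<longleftrightarrow>
     (\<forall>j<p. \<forall>l::nat. int l \<le> \<lfloor>(real n - real j - 1) / real p\<rfloor> \<longrightarrow>
        nikishin_integral \<sigma> 0 j (\<lambda>z. poly P z * z ^ l) = 0)"

definition mop :: "nat \<Rightarrow> (nat \<Rightarrow> complex measure) \<Rightarrow> nat \<Rightarrow> complex poly" where
  "mop p \<sigma> n = (THE P. lead_coeff P = 1 \<and> multi_orthogonal p \<sigma> n P \<and>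
     (\<forall>R. lead_coeff R = 1 \<and> multi_orthogonal p \<sigma> n R \<longrightarrow> degree P \<le> degree R))"

text \<open>
  In the following, \<open>l\<close> is the residue of \<open>degree (mop p \<sigma> n)\<close> modulo \<open>p + 1\<close>, and
  \<open>reduced_mop p \<sigma> n l\<close> is the polynomial \<open>R\<close> with \<open>mop p \<sigma> n (t) = t ^ l * R (t ^ (p + 1))\<close>.
\<close>

definition reduced_mop :: "nat \<Rightarrow> (nat \<Rightarrow> complex measure) \<Rightarrow> nat \<Rightarrow> nat \<Rightarrow> complex poly" where
  "reduced_mop p \<sigma> n l =
     (THE R. mop p \<sigma> n = monom 1 l * pcompose R (monom 1 (p + 1)))"

primrec second_kind ::
  "nat \<Rightarrow> (nat \<Rightarrow> complex measure) \<Rightarrow> nat \<Rightarrow> nat \<Rightarrow> complex \<Rightarrow> complex" where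
  "second_kind p \<sigma> n 0 = (\<lambda>z. poly (mop p \<sigma> n) z)"
| "second_kind p \<sigma> n (Suc k) = (\<lambda>z. LINT t|\<sigma> k. second_kind p \<sigma> n k t / (z - t))"

definition reduced_second_kind ::
  "nat \<Rightarrow> (nat \<Rightarrow> complex measure) \<Rightarrow> nat \<Rightarrow> nat \<Rightarrow> nat \<Rightarrow> complex \<Rightarrow> complex" where
  "reduced_second_kind p \<sigma> n l k z =
     (if k = 0 then poly (reduced_mop p \<sigma> n l) z
      else if l < k then
        z * (LINT t|\<sigma> (k - 1). second_kind p \<sigma> n (k - 1) t * t ^ (k - 1 - l) / (z - t ^ (p + 1)))
      else
        (LINT t|\<sigma> (k - 1). second_kind p \<sigma> n (k - 1) t * t ^ (p + k - l) / (z - t ^ (p + 1))))"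

definition M_count :: "nat \<Rightarrow> nat \<Rightarrow> nat \<Rightarrow> nat \<Rightarrow> nat" where
  "M_count p n l j =
     card {s::int. \<lceil>(real l - real j) / (real p + 1)\<rceil> \<le> s \<and>
       s \<le> \<lfloor>(real n + real p * real l - 1 - real j * (real p + 1)) / (real p * (real p + 1))\<rfloor>}"

definition Z_count :: "nat \<Rightarrow> nat \<Rightarrow> nat \<Rightarrow> nat \<Rightarrow> nat" where
  "Z_count p n l k = (\<Sum>j\<in>{k..<p}. M_count p n l j)"

text \<open>
  The third conjunct excludes functions vanishing identically near \<open>z\<close>, for which \<open>zorder\<close>
  is unspecified.
\<close>

definition odd_zero :: "(complex \<Rightarrow> complex) \<Rightarrow> complex \<Rightarrow> bool" where
  "odd_zero f z \<longleftrightarrow>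
     f analytic_on {z} \<and> f z = 0 \<and> (\<forall>\<^sub>F w in at z. f w \<noteq> 0) \<and> odd (zorder f z)"

end

theory Submission
  imports Defs
begin

text \<open>
  By rotation invariance everything factors through \<open>z \<mapsto> z ^ (p + 1)\<close>: the functions \<open>\<psi> k\<close> satisfy
  a recursion of Cauchy transforms with respect to the push-forwards \<open>\<mu> k\<close> of the measures
  \<open>\<sigma> k\<close> to the real intervals \<open>[a k, b k]\<close>, and \<open>\<psi> k\<close> is orthogonal to \<open>M_count p n l k\<close>
  consecutive powers with respect to \<open>\<mu> k\<close>. A zero \<open>x\<close> of \<open>\<psi> (k + 1)\<close> in \<open>(a (k + 1), b (k + 1))\<close>
  says that \<open>\<psi> k\<close> is also orthogonal to \<open>1 / (x - s)\<close>. By partial fractions \<open>\<psi> k\<close> is then orthogonal to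
  all \<open>P / q\<close>, where \<open>q\<close> vanishes exactly at the known zeros of \<open>\<psi> (k + 1)\<close> and
  \<open>degree P < M_count p n l k + degree q\<close>, so that \<open>\<psi> k\<close> has at least
  \<open>M_count p n l k + degree q\<close> sign changes. Descending induction on \<open>k\<close> gives \<open>Z_count\<close>. For
  \<open>k = 0\<close> the pairs counted by \<open>Z_count p n l 0\<close> include one for each \<open>m < n\<close> congruent to \<open>l\<close>
  modulo \<open>p + 1\<close> (with \<open>j = m mod p\<close>), which forces degree \<open>n\<close> and simple roots.
\<close>

section \<open>Sign changes and orthogonality on an interval\<close>

text \<open>Counting zeros of odd multiplicity presupposes that \<open>\<psi> k\<close> has isolated
  zeros, and the recursion does not say this directly. The lower bound itself supplies it:
  infinitely many zeros of \<open>\<psi> (k + 1)\<close> in its interval would force more odd zeros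
  of \<open>\<psi> k\<close> than the finitely many it has. So finiteness climbs from the nonzero
  polynomial \<open>\<psi> 0\<close> upwards, whereas the count descends. The moments of
  \<open>\<psi> k\<close> come from a stronger statement about the unreduced
  \<open>\<Psi> k\<close>: it is orthogonal to \<open>t ^ s\<close> against every measure s_{k,j}
  with \<open>k \<le> j\<close> and \<open>p * s + j < n\<close>, which Fubini passes from one level
  to the next. Only \<open>j = k\<close> is used in the end, with those \<open>s\<close> for which
  \<open>\<Psi> k t * t ^ s\<close> is a function of \<open>t ^ N\<close>, where N is p + 1. The two
  cases in the definition of the reduced functions leave a weight \<open>s ^ \<epsilon> k\<close> or
  an outer factor \<open>z\<close>; both are harmless because every interval lies on one side of 0.
  Sign arguments need real values, which come from conjugation invariance of the measures and
  uniqueness of the minimal monic polynomial.\<close>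

lemma constant_sign_on_interval:
  fixes G :: "real \<Rightarrow> real"
  assumes "a < b" and cont: "continuous_on {a..b} G"
    and loc: "\<And>x. x \<in> {a<..<b} \<Longrightarrow> (\<forall>\<^sub>F s in at x. G s > 0) \<or> (\<forall>\<^sub>F s in at x. G s < 0)"
  shows "(\<forall>x\<in>{a..b}. G x \<ge> 0) \<or> (\<forall>x\<in>{a..b}. G x \<le> 0)"
proof -
  \<comment> \<open>A punctured neighbourhood of \<open>x\<close> on which the sign condition holds
    serves every other point \<open>y\<close> of it as well. Hence both sign sets are open, and
    connectedness of the open interval leaves only one of them.\<close>
  have op: "open {x\<in>{a<..<b}. \<forall>\<^sub>F s in at x. Q (G s)}" for Q
  proof (subst open_subopen, rule ballI)
    fix x assume "x \<in> {x\<in>{a<..<b}. \<forall>\<^sub>F s in at x. Q (G s)}"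
    then obtain U where U: "open U" "x \<in> U" "\<forall>y\<in>U. y \<noteq> x \<longrightarrow> Q (G y)" and x: "x \<in> {a<..<b}"
      unfolding eventually_at_topological by blast
    have "\<forall>\<^sub>F s in at y. Q (G s)" if "y \<in> U" for y
    proof (cases "y = x")
      case True
      then show ?thesis using U unfolding eventually_at_topological by blast
    next
      case False
      have "open (U - {x})" "y \<in> U - {x}" using U that False by auto
      then show ?thesis using U unfolding eventually_at_topological by blast
    qed
    then have "U \<inter> {a<..<b} \<subseteq> {x\<in>{a<..<b}. \<forall>\<^sub>F s in at x. Q (G s)}" by auto
    moreover have "open (U \<inter> {a<..<b})" "x \<in> U \<inter> {a<..<b}" using U x by auto
    ultimately show "\<exists>T. open T \<and> x \<in> T \<and> T \<subseteq> {x\<in>{a<..<b}. \<forall>\<^sub>F s in at x. Q (G s)}" by blast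
  qed
  let ?A = "{x\<in>{a<..<b}. \<forall>\<^sub>F s in at x. G s > 0}"
  let ?B = "{x\<in>{a<..<b}. \<forall>\<^sub>F s in at x. G s < 0}"
  have "?A \<inter> ?B \<inter> {a<..<b} = {}"
  proof -
    have False if "\<forall>\<^sub>F s in at x. G s > 0" "\<forall>\<^sub>F s in at x. G s < 0" for x
    proof -
      have "\<forall>\<^sub>F s in at x. False"
        using that by eventually_elim simp
      then show False by simp
    qed
    then show ?thesis by blast
  qed
  moreover have "{a<..<b} \<subseteq> ?A \<union> ?B" using loc by blast
  ultimately have "?A \<inter> {a<..<b} = {} \<or> ?B \<inter> {a<..<b} = {}"
    using op[of "\<lambda>y. y > 0"] op[of "\<lambda>y. y < 0"] by (intro connectedD) auto
  then have AB: "{a<..<b} \<subseteq> ?A \<or> {a<..<b} \<subseteq> ?B" using loc by blast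
  have cl: "closure {a<..<b} = {a..b}" using \<open>a < b\<close> by simp
  have lim: "(G \<longlongrightarrow> G x) (at x)" if "x \<in> {a<..<b}" for x
    using cont that by (metis continuous_on_interior interior_atLeastAtMost_real isContD)
  from AB show ?thesis
  proof
    assume A: "{a<..<b} \<subseteq> ?A"
    have "G x \<ge> 0" if "x \<in> {a<..<b}" for x
    proof (rule tendsto_lowerbound[OF lim[OF that]])
      have "\<forall>\<^sub>F s in at x. G s > 0" using A that by blast
      then show "\<forall>\<^sub>F s in at x. 0 \<le> G s" by (rule eventually_mono) simp
    qed simp
    then show ?thesis
      using continuous_ge_on_closure[of "{a<..<b}" G _ 0] cont cl by auto
  next
    assume A: "{a<..<b} \<subseteq> ?B"
    have "G x \<le> 0" if "x \<in> {a<..<b}" for x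
    proof (rule tendsto_upperbound[OF lim[OF that]])
      have "\<forall>\<^sub>F s in at x. G s < 0" using A that by blast
      then show "\<forall>\<^sub>F s in at x. G s \<le> 0" by (rule eventually_mono) simp
    qed simp
    then show ?thesis
      using continuous_le_on_closure[of "{a<..<b}" G _ 0] cont cl by auto
  qed
qed

text \<open>Near \<open>x\<close>, \<open>f\<close> is a nonvanishing \<open>g\<close> times the
  power \<open>m\<close> of the distance to \<open>x\<close>. The product over \<open>S\<close>
  contributes one more factor \<open>s - x\<close> exactly when \<open>m\<close> is odd, so the
  total exponent \<open>q\<close> is even and the sign is that of a continuous factor that does not
  vanish at \<open>x\<close>.\<close>

lemma local_sign_after_removing_odd_zeros:
  fixes f :: "complex \<Rightarrow> complex"
  assumes ana: "f analytic_on {complex_of_real x}"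
    and nz: "\<forall>\<^sub>F w in at (complex_of_real x). f w \<noteq> 0"
    and real: "\<And>s. s \<in> {a<..<b} \<Longrightarrow> f (complex_of_real s) \<in> \<real>"
    and x: "x \<in> {a<..<b}" and S: "finite S" "x \<in> S \<longleftrightarrow> odd_zero f (complex_of_real x)"
  shows "(\<forall>\<^sub>F s in at x. Re (f (complex_of_real s)) * (\<Prod>y\<in>S. s - y) > 0) \<or>
         (\<forall>\<^sub>F s in at x. Re (f (complex_of_real s)) * (\<Prod>y\<in>S. s - y) < 0)"
proof -
  let ?z = "complex_of_real x"
  obtain e where e: "e > 0" "f holomorphic_on ball ?z e"
    using ana by (auto simp: analytic_on_def)
  have "\<exists>w\<in>ball ?z e. f w \<noteq> 0"
  proof -
    have "\<forall>\<^sub>F w in at ?z. w \<in> ball ?z e"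
      using e by (intro eventually_at_in_open') auto
    with nz have "\<forall>\<^sub>F w in at ?z. f w \<noteq> 0 \<and> w \<in> ball ?z e" by eventually_elim simp
    from eventually_happens[OF this] show ?thesis by auto
  qed
  moreover have "?z \<in> ball ?z e" using e by simp
  ultimately have *: "(if f ?z = 0 then zorder f ?z > 0 else zorder f ?z = 0) \<and>
      (\<exists>r>0. cball ?z r \<subseteq> ball ?z e \<and> zor_poly f ?z holomorphic_on cball ?z r \<and>
        (\<forall>w\<in>cball ?z r. f w = zor_poly f ?z w * (w - ?z) ^ nat (zorder f ?z) \<and> zor_poly f ?z w \<noteq> 0))"
    using zorder_exist_zero[OF e(2) open_ball connected_ball] by blast
  then
  obtain r where zo: "if f ?z = 0 then zorder f ?z > 0 else zorder f ?z = 0"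
    and r: "r > 0" "cball ?z r \<subseteq> ball ?z e" and hol: "zor_poly f ?z holomorphic_on cball ?z r"
    and fac: "\<And>w. w \<in> cball ?z r \<Longrightarrow> f w = zor_poly f ?z w * (w - ?z) ^ nat (zorder f ?z) \<and> zor_poly f ?z w \<noteq> 0"
    by blast
  define g where "g = zor_poly f ?z"
  define m where "m = nat (zorder f ?z)"
  have odd_m: "odd m \<longleftrightarrow> x \<in> S"
  proof -
    have "zorder f ?z \<ge> 0" using zo by (auto split: if_splits)
    then have "odd m \<longleftrightarrow> odd (zorder f ?z)" unfolding m_def by (metis even_nat_iff)
    also have "\<dots> \<longleftrightarrow> odd_zero f ?z"
      using zo ana nz by (auto simp: odd_zero_def split: if_splits)
    finally show ?thesis using S by simp
  qed
  have gnz: "g ?z \<noteq> 0" using fac[of ?z] r by (auto simp: g_def)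
  have "continuous_on (cball ?z r) g" using hol unfolding g_def by (rule holomorphic_on_imp_continuous_on)
  then have contg: "isCont g ?z" using r
    by (metis centre_in_ball continuous_on_interior interior_cball)
  have limg: "((\<lambda>s. g (complex_of_real s)) \<longlongrightarrow> g ?z) (at x)"
  proof -
    have "isCont (\<lambda>s. g (complex_of_real s)) x"
      using contg by (intro isCont_o2[of x complex_of_real g]) (auto intro: continuous_intros)
    then show ?thesis by (auto dest: isContD)
  qed
  have near: "\<forall>\<^sub>F s in at x. s \<in> {a<..<b} \<and> s \<in> ball x r \<and> s \<noteq> x"
  proof -
    have "\<forall>\<^sub>F s in at x. s \<in> ({a<..<b} \<inter> ball x r) - {x}"
      using x r by (intro eventually_at_in_open) auto
    then show ?thesis by (auto elim: eventually_mono)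
  qed
  have fac': "f (complex_of_real s) = g (complex_of_real s) * complex_of_real ((s - x) ^ m)"
    if "s \<in> ball x r" for s
  proof -
    have "complex_of_real s \<in> cball ?z r" using that
      by (simp add: dist_of_real less_imp_le)
    from fac[OF this] show ?thesis by (simp add: g_def m_def)
  qed
  \<comment> \<open>At \<open>x\<close> itself the quotient defining \<open>g\<close> is 0/0 when
    \<open>m > 0\<close>; reality there is the limit of real values at
    \<open>s \<noteq> x\<close>.\<close>
  have greal: "g ?z \<in> \<real>"
  proof -
    have "closed (\<real> :: complex set)" by (rule closed_complex_Reals)
    moreover have "\<forall>\<^sub>F s in at x. g (complex_of_real s) \<in> \<real>"
      using near
    proof eventually_elim
      case (elim s)
      then have "g (complex_of_real s) = f (complex_of_real s) / complex_of_real ((s - x) ^ m)"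
        using fac'[of s] by (simp add: field_simps)
      then show ?case using real[of s] elim by (auto intro!: Reals_divide)
    qed
    ultimately show ?thesis using limg by (intro Lim_in_closed_set[OF _ _ _ limg]) auto
  qed
  define h where "h = (\<lambda>s. Re (g (complex_of_real s)) * (\<Prod>y\<in>S - {x}. s - y))"
  have hx: "h x \<noteq> 0"
    using gnz greal S by (auto simp: h_def complex_is_Real_iff complex_eq_iff)
  have limh: "(h \<longlongrightarrow> h x) (at x)"
    unfolding h_def by (intro tendsto_intros limg)
  define q where "q = m + (if x \<in> S then 1 else 0)"
  have evq: "even q" using odd_m by (auto simp: q_def)
  have eq: "Re (f (complex_of_real s)) * (\<Prod>y\<in>S. s - y) = h s * (s - x) ^ q"
    if "s \<in> ball x r" for s
  proof -
    have "Re (f (complex_of_real s)) = Re (g (complex_of_real s)) * (s - x) ^ m"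
      unfolding fac'[OF that] by simp
    moreover have "(\<Prod>y\<in>S. s - y) = (\<Prod>y\<in>S - {x}. s - y) * (s - x) ^ (if x \<in> S then 1 else 0)"
      using S(1) by (auto simp: prod.remove mult.commute)
    ultimately show ?thesis by (simp add: h_def q_def power_add)
  qed
  have pos: "(s - x) ^ q > 0" if "s \<noteq> x" for s
    using evq that by (simp add: zero_less_power_eq)
  consider "h x > 0" | "h x < 0" using hx by linarith
  then show ?thesis
  proof cases
    case 1
    have "\<forall>\<^sub>F s in at x. h s > 0" using order_tendstoD(1)[OF limh 1] .
    with near have "\<forall>\<^sub>F s in at x. Re (f (complex_of_real s)) * (\<Prod>y\<in>S. s - y) > 0"
      by eventually_elim (use eq pos in auto)
    then show ?thesis ..
  next
    case 2
    have "\<forall>\<^sub>F s in at x. h s < 0" using order_tendstoD(2)[OF limh 2] .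
    with near have "\<forall>\<^sub>F s in at x. Re (f (complex_of_real s)) * (\<Prod>y\<in>S. s - y) < 0"
      by eventually_elim (use eq pos in \<open>auto simp: mult_less_0_iff\<close>)
    then show ?thesis ..
  qed
qed

text \<open>The identity theorem: otherwise \<open>f\<close> vanishes on a disc around
  \<open>x\<close>, and the disc contains infinitely many real points of the interval.\<close>

lemma eventually_nonzero_if_finitely_many_real_zeros:
  fixes f :: "complex \<Rightarrow> complex"
  assumes ana: "f analytic_on {complex_of_real x}" and x: "x \<in> {a<..<b}"
    and fin: "finite {s\<in>{a..b}. f (complex_of_real s) = 0}"
  shows "\<forall>\<^sub>F w in at (complex_of_real x). f w \<noteq> 0"
proof -
  let ?z = "complex_of_real x"
  obtain e where e: "e > 0" "f holomorphic_on ball ?z e"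
    using ana by (auto simp: analytic_on_def)
  have "\<exists>w\<in>ball ?z e. f w \<noteq> 0"
  proof (rule ccontr)
    assume "\<not> ?thesis"
    then have z: "f (complex_of_real s) = 0" if "s \<in> ball x e" for s
      using that by (auto simp: dist_of_real)
    have "infinite {max a (x - e)<..<min b (x + e)}"
      using x e by simp
    moreover have "{max a (x - e)<..<min b (x + e)} \<subseteq> {s\<in>{a..b}. f (complex_of_real s) = 0}"
      using z by (auto simp: dist_real_def)
    ultimately show False using fin finite_subset by blast
  qed
  then obtain w where "w \<in> ball ?z e" "f w \<noteq> 0" by blast
  then have "\<forall>\<^sub>F w in at ?z. f w \<noteq> 0 \<and> w \<in> ball ?z e"
    using e by (intro non_zero_neighbour_alt[OF e(2)]) auto
  then show ?thesis by (auto elim: eventually_mono)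
qed

lemma integrable_continuous_on_interval:
  fixes h :: "real \<Rightarrow> real"
  assumes "finite_measure \<mu>" "sets \<mu> = sets borel" "AE s in \<mu>. s \<in> {a..b}"
    and "h \<in> borel_measurable borel" "continuous_on {a..b} h"
  shows "integrable \<mu> h"
proof -
  have "bounded (h ` {a..b})"
    using assms(5) by (intro compact_imp_bounded compact_continuous_image) auto
  then obtain B where B: "\<And>s. s \<in> {a..b} \<Longrightarrow> norm (h s) \<le> B"
    unfolding bounded_iff by blast
  show ?thesis
  proof (rule finite_measure.integrable_const_bound[OF assms(1)])
    show "AE s in \<mu>. norm (h s) \<le> B" using assms(3) by eventually_elim (rule B)
    show "h \<in> borel_measurable \<mu>" using assms(2,4) measurable_cong_sets by blast
  qed
qed

text \<open>One pole is split off at a time: \<open>\<alpha>\<close> is chosen so that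
  \<open>P - \<alpha> q\<close> vanishes at \<open>y\<close>, and the quotient \<open>P1\<close> has
  lost one degree along with the pole. The alternative \<open>P = 0\<close> is needed because the
  zero polynomial has degree 0, which is not below \<open>M + card X\<close> when both are
  0.\<close>

lemma orthogonality_partial_fractions:
  fixes F :: "real \<Rightarrow> real" and P :: "real poly"
  assumes mu: "finite_measure \<mu>" "sets \<mu> = sets borel" "AE s in \<mu>. s \<in> {a..b}"
    and F: "F \<in> borel_measurable borel" "continuous_on {a..b} F"
    and X: "finite X" "X \<inter> {a..b} = {}"
    and mom: "\<And>r. r < M \<Longrightarrow> (LINT s|\<mu>. F s * s ^ r) = 0"
    and cau: "\<And>x. x \<in> X \<Longrightarrow> (LINT s|\<mu>. F s / (s - x)) = 0"
    and P: "P = 0 \<or> degree P < M + card X"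
  shows "(LINT s|\<mu>. F s * poly P s / (\<Prod>y\<in>X. s - y)) = 0"
proof -
  note [measurable] = F(1)
  have [measurable]: "(\<lambda>s. poly R s) \<in> borel_measurable borel" for R :: "real poly"
    by (intro borel_measurable_continuous_onI continuous_intros)
  show ?thesis using X cau P
  proof (induction X arbitrary: P rule: finite_induct)
    case empty
    have int: "integrable \<mu> (\<lambda>s. F s * (coeff P i * s ^ i))" for i
      by (rule integrable_continuous_on_interval[OF mu], measurable) (intro continuous_intros F)
    have "(LINT s|\<mu>. F s * poly P s) = (LINT s|\<mu>. (\<Sum>i\<le>degree P. F s * (coeff P i * s ^ i)))"
      by (simp add: poly_altdef sum_distrib_left)
    also have "\<dots> = (\<Sum>i\<le>degree P. LINT s|\<mu>. F s * (coeff P i * s ^ i))"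
      by (rule Bochner_Integration.integral_sum) (rule int)
    also have "\<dots> = (\<Sum>i\<le>degree P. coeff P i * (LINT s|\<mu>. F s * s ^ i))"
      unfolding mult.left_commute[of "F _"] by simp
    also have "\<dots> = 0"
      using empty.prems(3) mom by (intro sum.neutral) auto
    finally show ?case by simp
  next
    case (insert y Y)
    define q where "q = (\<Prod>u\<in>Y. [:-u, 1:])"
    have qs: "poly q s = (\<Prod>u\<in>Y. s - u)" for s by (simp add: q_def poly_prod)
    have qy: "poly q y \<noteq> 0" using insert.hyps by (auto simp: qs)
    have q0: "poly q s \<noteq> 0" if "s \<in> {a..b}" for s
      using insert.hyps insert.prems(1) that by (auto simp: qs)
    have degq: "degree q = card Y" unfolding q_def
      by (subst degree_prod_eq_sum_degree) auto
    define \<alpha> where "\<alpha> = poly P y / poly q y"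
    have "poly (P - smult \<alpha> q) y = 0" using qy by (simp add: \<alpha>_def)
    then obtain P1 where P1: "P - smult \<alpha> q = [:-y, 1:] * P1"
      by (metis poly_eq_0_iff_dvd dvdE)
    have degP1: "P1 = 0 \<or> degree P1 < M + card Y"
    proof (cases "P = 0")
      case True
      then have "[:-y, 1:] * P1 = 0" using P1 by (simp add: \<alpha>_def del: mult_pCons_left)
      then have "P1 = 0" unfolding mult_eq_0_iff by simp
      then show ?thesis ..
    next
      case False
      then have "degree P \<le> M + card Y" using insert by auto
      moreover have "degree (smult \<alpha> q) \<le> card Y" using degq by (simp add: degree_smult_le)
      ultimately have "degree ([:-y, 1:] * P1) \<le> M + card Y"
        unfolding P1[symmetric] by (intro degree_diff_le) auto
      then show ?thesis
        by (cases "P1 = 0") (auto simp: degree_mult_eq simp del: mult_pCons_left)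
    qed
    have 1: "(LINT s|\<mu>. F s * poly P1 s / poly q s) = 0"
      unfolding qs using insert.prems degP1 by (intro insert.IH) auto
    have 2: "(LINT s|\<mu>. F s / (s - y)) = 0" using insert.prems by auto
    have ys: "s - y \<noteq> 0" if "s \<in> {a..b}" for s using insert.prems that by auto
    have int1: "integrable \<mu> (\<lambda>s. F s * poly P1 s / poly q s)"
      by (rule integrable_continuous_on_interval[OF mu], measurable) (use q0 in \<open>auto intro!: continuous_intros F\<close>)
    have int2: "integrable \<mu> (\<lambda>s. F s / (s - y))"
      by (rule integrable_continuous_on_interval[OF mu], measurable) (use ys in \<open>auto intro!: continuous_intros F\<close>)
    have int3: "integrable \<mu> (\<lambda>s. F s * poly P s / (\<Prod>u\<in>insert y Y. s - u))"
      by (rule integrable_continuous_on_interval[OF mu], measurable)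
        (use ys q0 insert.hyps in \<open>auto simp: qs intro!: continuous_intros F\<close>)
    have "(LINT s|\<mu>. F s * poly P s / (\<Prod>u\<in>insert y Y. s - u)) =
          (LINT s|\<mu>. \<alpha> * (F s / (s - y)) + F s * poly P1 s / poly q s)"
    proof (rule integral_cong_AE)
      show "AE s in \<mu>. F s * poly P s / (\<Prod>u\<in>insert y Y. s - u) =
          \<alpha> * (F s / (s - y)) + F s * poly P1 s / poly q s"
        using mu(3)
      proof eventually_elim
        case (elim s)
        have Peq: "poly P s = \<alpha> * poly q s + (s - y) * poly P1 s"
        proof -
          have "P = smult \<alpha> q + [:-y, 1:] * P1" using P1 by (simp add: algebra_simps)
          then have "poly P s = poly (smult \<alpha> q + [:-y, 1:] * P1) s" by simp
          then show ?thesis by (simp add: algebra_simps)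
        qed
        have "F s * poly P s / ((s - y) * poly q s) = \<alpha> * (F s / (s - y)) + F s * poly P1 s / poly q s"
          unfolding Peq using ys[OF elim] q0[OF elim] by (simp add: divide_simps) (simp add: algebra_simps)
        moreover have "(\<Prod>u\<in>insert y Y. s - u) = (s - y) * poly q s"
          using insert.hyps by (simp add: qs)
        ultimately show ?case by simp
      qed
    qed (use int1 int2 int3 in \<open>auto intro!: borel_measurable_integrable simp del: times_divide_eq_right\<close>)
    also have "\<dots> = \<alpha> * (LINT s|\<mu>. F s / (s - y)) + (LINT s|\<mu>. F s * poly P1 s / poly q s)"
      using int1 int2 by (simp del: times_divide_eq_right)
    finally show ?case using 1 2 by simp
  qed
qed

text \<open>A multiplier replaces a case distinction on the sign, so that the signs of several
  factors can later be combined by multiplying the constants.\<close>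

lemma prod_diff_constant_sign:
  fixes X :: "real set"
  assumes "finite X" "X \<inter> {a..b} = {}"
  shows "\<exists>c::real. \<forall>s\<in>{a..b}. c * (\<Prod>y\<in>X. s - y) > 0"
  using assms
proof (induction rule: finite_induct)
  case empty
  then show ?case by (intro exI[of _ 1]) auto
next
  case (insert y Y)
  then obtain c where c: "\<forall>s\<in>{a..b}. c * (\<Prod>y\<in>Y. s - y) > 0" by auto
  define d :: real where "d = (if y < a then 1 else -1)"
  have "d * (s - y) > 0" if "s \<in> {a..b}" for s
    using insert.prems that by (auto simp: d_def)
  then have "(d * (s - y)) * (c * (\<Prod>y\<in>Y. s - y)) > 0" if "s \<in> {a..b}" for s
    using c that mult_pos_pos by blast
  then show ?case using insert.hyps
    by (intro exI[of _ "d * c"]) (simp add: mult_ac)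
qed

text \<open>With too few odd zeros, the polynomial \<open>P\<close> vanishing at them has small
  enough degree for the integral of \<open>f s ^ e P\<close> over the product of \<open>X\<close> to
  be 0. That integrand has constant sign, hence vanishes almost everywhere, and \<open>\<mu>\<close>
  would live on a finite set.\<close>

lemma odd_zeros_lower_bound:
  fixes f :: "complex \<Rightarrow> complex" and \<mu> :: "real measure"
  assumes mu: "finite_measure \<mu>" "sets \<mu> = sets borel" "AE s in \<mu>. s \<in> {a..b}"
    and inf: "\<And>A. finite A \<Longrightarrow> \<not> (AE s in \<mu>. s \<in> A)"
    and ab: "a < b" "0 \<le> a \<or> b \<le> 0"
    and ana: "f analytic_on complex_of_real ` {a..b}"
    and meas: "f \<in> borel_measurable borel"
    and real: "\<And>s. s \<in> {a..b} \<Longrightarrow> f (complex_of_real s) \<in> \<real>"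
    and fin: "finite {s\<in>{a..b}. f (complex_of_real s) = 0}"
    and X: "finite X" "X \<inter> {a..b} = {}"
    and mom: "\<And>r. r < M \<Longrightarrow> (LINT s|\<mu>. Re (f (complex_of_real s)) * s ^ e * s ^ r) = 0"
    and cau: "\<And>x. x \<in> X \<Longrightarrow> (LINT s|\<mu>. Re (f (complex_of_real s)) * s ^ e / (x - s)) = 0"
  shows "M + card X \<le> card {x\<in>{a<..<b}. odd_zero f (complex_of_real x)}"
proof (rule ccontr)
  define S where "S = {x\<in>{a<..<b}. odd_zero f (complex_of_real x)}"
  assume "\<not> ?thesis"
  then have card: "card S < M + card X" by (simp add: S_def)
  have "S \<subseteq> {s\<in>{a..b}. f (complex_of_real s) = 0}"
    by (auto simp: S_def odd_zero_def)
  then have finS: "finite S" using fin finite_subset by blast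
  have anax: "f analytic_on {complex_of_real x}" if "x \<in> {a..b}" for x
    using ana that by (meson analytic_on_subset empty_subsetI image_eqI insert_subset)
  have contf: "continuous_on {a..b} (\<lambda>s. f (complex_of_real s))"
    by (rule continuous_on_compose2[OF analytic_imp_holomorphic[OF ana, THEN holomorphic_on_imp_continuous_on]])
      (auto intro: continuous_intros)
  define P where "P = (\<Prod>y\<in>S. [:-y, 1:])"
  have Ps: "poly P s = (\<Prod>y\<in>S. s - y)" for s by (simp add: P_def poly_prod)
  have degP: "degree P = card S" unfolding P_def
    by (subst degree_prod_eq_sum_degree) auto
  define G where "G = (\<lambda>s. Re (f (complex_of_real s)) * poly P s)"
  have "(\<forall>x\<in>{a..b}. G x \<ge> 0) \<or> (\<forall>x\<in>{a..b}. G x \<le> 0)"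
  proof (rule constant_sign_on_interval[OF ab(1)])
    show "continuous_on {a..b} G"
      unfolding G_def by (intro continuous_intros contf)
    fix x assume x: "x \<in> {a<..<b}"
    show "(\<forall>\<^sub>F s in at x. G s > 0) \<or> (\<forall>\<^sub>F s in at x. G s < 0)"
      unfolding G_def Ps
    proof (rule local_sign_after_removing_odd_zeros[OF _ _ _ x finS])
      show "f analytic_on {complex_of_real x}" using x by (intro anax) auto
      then show "\<forall>\<^sub>F w in at (complex_of_real x). f w \<noteq> 0"
        using eventually_nonzero_if_finitely_many_real_zeros[OF _ x fin] by blast
      show "(x \<in> S) = odd_zero f (complex_of_real x)" using x by (simp add: S_def)
    qed (auto intro: real)
  qed
  then obtain c1 :: real where c1: "c1 \<noteq> 0" "\<And>s. s \<in> {a..b} \<Longrightarrow> c1 * G s \<ge> 0"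
  proof
    assume "\<forall>x\<in>{a..b}. 0 \<le> G x" then show ?thesis using that[of 1] by simp
  next
    assume "\<forall>x\<in>{a..b}. G x \<le> 0" then show ?thesis using that[of "-1"] by simp
  qed
  obtain c2 where c2: "\<And>s. s \<in> {a..b} \<Longrightarrow> c2 * (\<Prod>y\<in>X. s - y) > 0"
    using prod_diff_constant_sign[OF X] by blast
  have c20: "c2 \<noteq> 0" using c2[of a] ab by auto
  obtain c3 :: real where c3: "c3 \<noteq> 0" "\<And>s. s \<in> {a..b} \<Longrightarrow> c3 * s ^ e \<ge> 0"
    using ab(2)
  proof
    assume "0 \<le> a" then show ?thesis using that[of 1] by simp
  next
    assume "b \<le> 0"
    then have "(-1) ^ e * s ^ e \<ge> 0" if "s \<in> {a..b}" for s
      using that by (auto simp: power_mult_distrib[symmetric] intro!: zero_le_power)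
    then show ?thesis using that[of "(-1) ^ e"] by simp
  qed
  define h where "h = (\<lambda>s. Re (f (complex_of_real s)) * s ^ e * poly P s / (\<Prod>y\<in>X. s - y))"
  have q0: "(\<Prod>y\<in>X. s - y) \<noteq> 0" if "s \<in> {a..b}" for s using c2[OF that] by auto
  have measF: "(\<lambda>s. Re (f (complex_of_real s)) * s ^ e) \<in> borel_measurable borel"
    using meas by measurable
  have contF: "continuous_on {a..b} (\<lambda>s. Re (f (complex_of_real s)) * s ^ e)"
    by (intro continuous_intros contf)
  note [measurable] = measF
  have [measurable]: "(\<lambda>s. poly P s) \<in> borel_measurable borel"
    by (intro borel_measurable_continuous_onI continuous_intros)
  have inth: "integrable \<mu> h"
    unfolding h_def
    by (rule integrable_continuous_on_interval[OF mu], measurable)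
      (use q0 in \<open>auto intro!: continuous_intros contf\<close>)
  have "(LINT s|\<mu>. h s) = 0"
    unfolding h_def
  proof (rule orthogonality_partial_fractions[OF mu measF contF X mom])
    show "P = 0 \<or> degree P < M + card X" using card degP by simp
    fix x assume x: "x \<in> X"
    have "(LINT s|\<mu>. Re (f (complex_of_real s)) * s ^ e / (s - x)) =
          (LINT s|\<mu>. - (Re (f (complex_of_real s)) * s ^ e / (x - s)))"
      by (rule Bochner_Integration.integral_cong) (auto simp: minus_divide_right)
    then show "(LINT s|\<mu>. Re (f (complex_of_real s)) * s ^ e / (s - x)) = 0"
      using cau[OF x] by simp
  qed
  moreover have "c1 * c2 * c3 * h s \<ge> 0" if "s \<in> {a..b}" for s
  proof -
    have "c2 / (\<Prod>y\<in>X. s - y) > 0"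
      using c2[OF that] by (auto simp: zero_less_mult_iff zero_less_divide_iff)
    then have "(c1 * G s) * (c3 * s ^ e) * (c2 / (\<Prod>y\<in>X. s - y)) \<ge> 0"
      using c1(2)[OF that] c3(2)[OF that] mult_nonneg_nonneg less_imp_le by metis
    then show ?thesis by (simp add: h_def G_def mult_ac)
  qed
  then have "AE s in \<mu>. c1 * c2 * c3 * h s \<ge> 0" using mu(3) by auto
  ultimately have "AE s in \<mu>. c1 * c2 * c3 * h s = 0"
    using inth by (subst integral_nonneg_eq_0_iff_AE[symmetric]) auto
  \<comment> \<open>The point 0 is added because the weight \<open>s ^ e\<close> may vanish
    there.\<close>
  with mu(3) have "AE s in \<mu>. s \<in> {s\<in>{a..b}. f (complex_of_real s) = 0} \<union> S \<union> {0}"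
  proof eventually_elim
    case (elim s)
    then have "h s = 0" using c1 c20 c3 by simp
    then have "Re (f (complex_of_real s)) = 0 \<or> s = 0 \<or> poly P s = 0"
      using q0[of s] elim by (auto simp: h_def)
    moreover have "f (complex_of_real s) = 0" if "Re (f (complex_of_real s)) = 0"
      using that real[of s] elim by (auto simp: complex_is_Real_iff complex_eq_iff)
    ultimately show ?case using elim finS by (auto simp: Ps)
  qed
  then show False using inf[of "{s\<in>{a..b}. f (complex_of_real s) = 0} \<union> S \<union> {0}"] fin finS by blast
qed

section \<open>Cauchy transforms and common kernels of functionals on polynomials\<close>

text \<open>Differentiation under the integral sign by dominated convergence: on a disc of half the
  distance \<open>e\<close> to \<open>K\<close> the kernel is at most \<open>2 / e\<close>. The pole
  is at \<open>u t\<close> rather than \<open>t\<close> so that the kernel in \<open>t ^ N\<close>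
  is included.\<close>

lemma holomorphic_on_Cauchy_transform:
  fixes g u :: "'a \<Rightarrow> complex"
  assumes fm: "finite_measure M" and [measurable]: "g \<in> borel_measurable M" "u \<in> borel_measurable M"
    and bnd: "AE t in M. norm (g t) \<le> B" and K: "closed K" "AE t in M. u t \<in> K"
  shows "(\<lambda>z. LINT t|M. g t / (z - u t)) holomorphic_on (- K)"
proof -
  interpret finite_measure M by fact
  have "((\<lambda>z. LINT t|M. g t / (z - u t)) has_field_derivative (LINT t|M. - g t / (w - u t)^2)) (at w)"
    if wK: "w \<in> - K" for w
  proof -
    obtain e where e: "e > 0" "ball w e \<subseteq> - K"
      using K(1) wK by (meson open_Compl open_contains_ball_eq)
    have far: "norm (z - u t) \<ge> e / 2" if "z \<in> ball w (e / 2)" "u t \<in> K" for z t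
    proof (rule ccontr)
      assume "\<not> ?thesis"
      then have "dist z (u t) < e / 2" by (simp add: dist_norm)
      moreover have "dist w z < e / 2" using that by simp
      ultimately have "dist w (u t) < e" using dist_triangle[of w "u t" z] by simp
      then show False using e that by auto
    qed
    have int: "integrable M (\<lambda>t. g t / (z - u t))" if "z \<in> ball w (e / 2)" for z
    proof (rule integrable_const_bound)
      show "AE t in M. norm (g t / (z - u t)) \<le> B / (e / 2)"
        using bnd K(2)
      proof eventually_elim
        case (elim t)
        then show ?case unfolding norm_divide
          using far[OF that, of t] e by (intro frac_le) (auto intro: order_trans[OF norm_ge_zero])
      qed
    qed measurable
    have "((\<lambda>z. ((LINT t|M. g t / (z - u t)) - (LINT t|M. g t / (w - u t))) / (z - w))
        \<longlongrightarrow> (LINT t|M. - g t / (w - u t)^2)) (at w)"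
      unfolding tendsto_at_iff_sequentially
    proof (intro allI impI, unfold comp_def)
      fix X :: "nat \<Rightarrow> complex"
      assume X: "\<forall>i. X i \<in> UNIV - {w}" "X \<longlonglongrightarrow> w"
      have "\<forall>\<^sub>F i in sequentially. X i \<in> ball w (e / 2)"
        using X(2) e by (metis centre_in_ball half_gt_zero open_ball topological_tendstoD)
      \<comment> \<open>Replacing the integrand by 0 outside the half disc makes the domination hold
        for every \<open>i\<close>; only finitely many terms are changed.\<close>
      then have ev: "\<forall>\<^sub>F i in sequentially.
          (LINT t|M. (if X i \<in> ball w (e / 2) then - g t / ((X i - u t) * (w - u t)) else 0)) =
          ((LINT t|M. g t / (X i - u t)) - (LINT t|M. g t / (w - u t))) / (X i - w)"
      proof eventually_elim
        case (elim i)
        have w: "w \<in> ball w (e / 2)" using e by simp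
        have "(LINT t|M. g t / (X i - u t)) - (LINT t|M. g t / (w - u t)) =
           (LINT t|M. g t / (X i - u t) - g t / (w - u t))"
          by (rule Bochner_Integration.integral_diff[symmetric, OF int[OF elim] int[OF w]])
        also have "\<dots> = (LINT t|M. (X i - w) * (- g t / ((X i - u t) * (w - u t))))"
        proof (rule integral_cong_AE)
          show "AE t in M. g t / (X i - u t) - g t / (w - u t) =
             (X i - w) * (- g t / ((X i - u t) * (w - u t)))"
            using K(2)
          proof eventually_elim
            case t: (elim t)
            have "X i - u t \<noteq> 0" "w - u t \<noteq> 0" using far[OF elim t] far[OF w t] e by auto
            then show ?case by (simp add: divide_simps) (simp add: algebra_simps)
          qed
        qed measurable
        also have "\<dots> = (X i - w) * (LINT t|M. - g t / ((X i - u t) * (w - u t)))"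
          by (rule integral_mult_right_zero)
        finally show ?case using elim X(1) by auto
      qed
      have "(\<lambda>i. LINT t|M. (if X i \<in> ball w (e / 2) then - g t / ((X i - u t) * (w - u t)) else 0))
         \<longlonglongrightarrow> (LINT t|M. - g t / (w - u t)^2)"
      proof (rule integral_dominated_convergence[where w = "\<lambda>_. B / (e / 2)^2"])
        show "AE t in M. (\<lambda>i. if X i \<in> ball w (e / 2) then - g t / ((X i - u t) * (w - u t)) else 0)
            \<longlonglongrightarrow> - g t / (w - u t)^2"
          using K(2)
        proof eventually_elim
          case (elim t)
          have "w - u t \<noteq> 0" using elim wK by auto
          then have "(\<lambda>i. - g t / ((X i - u t) * (w - u t))) \<longlonglongrightarrow> - g t / ((w - u t) * (w - u t))"
            by (intro tendsto_intros X) auto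
          moreover have "\<forall>\<^sub>F i in sequentially. - g t / ((X i - u t) * (w - u t)) =
            (if X i \<in> ball w (e / 2) then - g t / ((X i - u t) * (w - u t)) else 0)"
            using \<open>\<forall>\<^sub>F i in sequentially. X i \<in> ball w (e / 2)\<close> by eventually_elim simp
          ultimately show ?case unfolding power2_eq_square by (rule Lim_transform_eventually)
        qed
        fix i
        show "AE t in M. norm (if X i \<in> ball w (e / 2) then - g t / ((X i - u t) * (w - u t)) else 0) \<le> B / (e / 2)^2"
          using K(2) bnd
        proof eventually_elim
          case (elim t)
          have B: "B \<ge> 0" using elim by (meson norm_ge_zero order_trans)
          show ?case
          proof (cases "X i \<in> ball w (e / 2)")
            case True
            have "norm (- g t / ((X i - u t) * (w - u t))) \<le> B / (e / 2)^2"
              unfolding norm_divide norm_mult power2_eq_square norm_minus_cancel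
              using far[OF True, of t] far[of w t] elim e B by (intro frac_le mult_mono) auto
            then show ?thesis using True by simp
          qed (use B in simp)
        qed
      qed (auto)
      then show "(\<lambda>i. ((LINT t|M. g t / (X i - u t)) - (LINT t|M. g t / (w - u t))) / (X i - w))
         \<longlonglongrightarrow> (LINT t|M. - g t / (w - u t)^2)"
        using ev by (rule Lim_transform_eventually)
    qed
    then show ?thesis by (simp add: has_field_derivative_iff)
  qed
  then show ?thesis
    by (auto simp: holomorphic_on_def field_differentiable_def intro: has_field_derivative_at_within)
qed

text \<open>Gaussian elimination that keeps track of degrees: each functional costs one element of
  \<open>D\<close>. The subspace \<open>V\<close> is arbitrary so that the induction can shrink it
  to the kernel of the functional just treated.\<close>

lemma exists_poly_in_common_kernel:
  fixes f :: "nat \<Rightarrow> 'a::field poly" and L :: "nat \<Rightarrow> 'a poly \<Rightarrow> 'a"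
  assumes "finite D" "m < card D"
    and f: "\<And>d. d \<in> D \<Longrightarrow> f d \<in> V \<and> f d \<noteq> 0 \<and> degree (f d) = d"
    and V: "\<And>P Q. P \<in> V \<Longrightarrow> Q \<in> V \<Longrightarrow> P + Q \<in> V" "\<And>c P. P \<in> V \<Longrightarrow> smult c P \<in> V"
    and L: "\<And>i P Q. L i (P + Q) = L i P + L i Q" "\<And>i c P. L i (smult c P) = c * L i P"
  shows "\<exists>Q\<in>V. Q \<noteq> 0 \<and> degree Q \<in> D \<and> (\<forall>i<m. L i Q = 0)"
  using assms(1-5)
proof (induction m arbitrary: D f V)
  case 0
  then obtain d where "d \<in> D" by fastforce
  with "0.prems"(3)[of d] show ?case by (intro bexI[of _ "f d"]) auto
next
  case (Suc m)
  show ?case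
  proof (cases "\<forall>d\<in>D. L m (f d) = 0")
    case True
    have "\<exists>Q\<in>V \<inter> {P. L m P = 0}. Q \<noteq> 0 \<and> degree Q \<in> D \<and> (\<forall>i<m. L i Q = 0)"
      using Suc.prems True by (intro Suc.IH[where f = f]) (auto simp: L)
    then show ?thesis by (auto simp: less_Suc_eq)
  next
    case False
    \<comment> \<open>The pivot has the least possible degree: polynomials of smaller degree need no
      correction, and correcting those of larger degree by a multiple of \<open>f d0\<close>
      preserves their degree.\<close>
    define d0 where "d0 = (LEAST d. d \<in> D \<and> L m (f d) \<noteq> 0)"
    have d0: "d0 \<in> D \<and> L m (f d0) \<noteq> 0"
      unfolding d0_def using False by (rule_tac LeastI_ex) blast
    have below: "L m (f d) = 0" if "d \<in> D" "d < d0" for d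
      using not_less_Least[of d "\<lambda>d. d \<in> D \<and> L m (f d) \<noteq> 0"] that unfolding d0_def by blast
    define h where "h = (\<lambda>d. f d + smult (- (L m (f d) / L m (f d0))) (f d0))"
    have "\<exists>Q\<in>V \<inter> {P. L m P = 0}. Q \<noteq> 0 \<and> degree Q \<in> D - {d0} \<and> (\<forall>i<m. L i Q = 0)"
    proof (rule Suc.IH[where f = h])
      show "m < card (D - {d0})" using Suc.prems(1,2) d0 by simp
      fix d assume d: "d \<in> D - {d0}"
      have "h d \<in> V" unfolding h_def using Suc.prems(3) d d0 by (intro Suc.prems(4,5)) auto
      moreover have "L m (h d) = 0" unfolding h_def L using d0 by simp
      moreover have "h d \<noteq> 0 \<and> degree (h d) = d"
      proof (cases "d < d0")
        case True
        then show ?thesis using below d Suc.prems(3) by (simp add: h_def)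
      next
        case False
        then have lt: "d0 < d" using d by auto
        have "degree (smult (- (L m (f d) / L m (f d0))) (f d0)) < degree (f d)"
          using Suc.prems(3)[of d] Suc.prems(3)[of d0] d d0 lt degree_smult_le[of _ "f d0"]
          by (metis DiffD1 le_less_trans)
        then have "degree (h d) = degree (f d)" unfolding h_def
          by (intro degree_add_eq_left) simp
        then have "degree (h d) = d" using Suc.prems(3)[of d] d by simp
        then show ?thesis using lt by auto
      qed
      ultimately show "h d \<in> V \<inter> {P. L m P = 0} \<and> h d \<noteq> 0 \<and> degree (h d) = d" by simp
    qed (use Suc.prems in \<open>auto simp: L\<close>)
    then show ?thesis by (auto simp: less_Suc_eq)
  qed
qed

section \<open>Measures on stars\<close>

text \<open>The rotation orbit of \<open>z\<close> runs once through the fibre of the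
  \<open>N\<close>-th power, except at 0, where it stays at one point. This turns averages over
  rotations into sums over fibres.\<close>

lemma sum_over_roots:
  fixes f :: "complex \<Rightarrow> 'b::semiring_1" and z :: complex
  assumes "N > 0"
  shows "(\<Sum>m<N. f (cis (2 * pi / N) ^ m * z)) =
    (if z = 0 then of_nat N * f 0 else \<Sum>w | w ^ N = z ^ N. f w)"
proof (cases "z = 0")
  case False
  have "bij_betw (\<lambda>m. cis (2 * pi * m / N)) {..<N} {w. w ^ N = 1}"
    using Complex.bij_betw_roots_unity[OF assms] by simp
  moreover have "bij_betw (\<lambda>u. u * z) {w. w ^ N = 1} {w. w ^ N = z ^ N}"
    by (rule bij_betwI[where g = "\<lambda>w. w / z"]) (use False in \<open>auto simp: power_mult_distrib power_divide\<close>)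
  ultimately have "bij_betw ((\<lambda>u. u * z) \<circ> (\<lambda>m. cis (2 * pi * m / N))) {..<N} {w. w ^ N = z ^ N}"
    by (rule bij_betw_trans)
  then have "(\<Sum>w | w ^ N = z ^ N. f w) = (\<Sum>m<N. f (cis (2 * pi * m / N) * z))"
    by (simp add: sum.reindex_bij_betw[symmetric, of _ "{..<N}"] comp_def)
  then show ?thesis using False by (simp add: Complex.DeMoivre mult_ac)
qed simp

locale star_nikishin =
  fixes p :: nat and a b :: "nat \<Rightarrow> real" and \<sigma> :: "nat \<Rightarrow> complex measure"
  assumes sys: "star_system p a b \<sigma>"
begin

definition N :: nat where "N = p + 1"
definition \<omega> :: complex where "\<omega> = cis (2 * pi / N)"
definition \<Gamma> :: "nat \<Rightarrow> complex set" where "\<Gamma> j = star_set p a b j"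

lemma p_pos: "p > 0" using sys by (simp add: star_system_def)

lemma N_pos [simp]: "N > 0" "N \<noteq> 0" "real N > 0" by (auto simp: N_def)

lemma \<omega>_nz [simp]: "\<omega> \<noteq> 0" by (simp add: \<omega>_def)

lemma \<omega>_power_N [simp]: "\<omega> ^ N = 1" by (simp add: \<omega>_def Complex.DeMoivre)

lemma \<omega>_power_eq_1: "\<omega> ^ k = 1 \<Longrightarrow> N dvd k"
proof -
  assume "\<omega> ^ k = 1"
  then have 1: "\<omega> ^ (k mod N) = 1"
  proof -
    have "\<omega> ^ k = \<omega> ^ (N * (k div N) + k mod N)" by simp
    also have "\<dots> = \<omega> ^ (k mod N)" unfolding power_add power_mult by simp
    finally show ?thesis using \<open>\<omega> ^ k = 1\<close> by simp
  qed
  have "inj_on (\<lambda>m. cis (2 * pi * real m / real N)) {..<N}"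
    using Complex.bij_betw_roots_unity[OF N_pos(1)] by (simp add: bij_betw_def)
  moreover have "cis (2 * pi * real (k mod N) / real N) = cis (2 * pi * real 0 / real N)"
    using 1 by (simp add: \<omega>_def Complex.DeMoivre mult_ac)
  ultimately have "k mod N = 0" by (rule inj_onD) auto
  then show ?thesis by auto
qed

lemma \<omega>_power_eq_iff: "\<omega> ^ i = \<omega> ^ k \<longleftrightarrow> i mod N = k mod N"
proof -
  have red: "\<omega> ^ i = \<omega> ^ (i mod N)" for i
  proof -
    have "\<omega> ^ i = \<omega> ^ (N * (i div N) + i mod N)" by simp
    also have "\<dots> = \<omega> ^ (i mod N)" unfolding power_add power_mult by simp
    finally show ?thesis .
  qed
  have "i mod N = k mod N" if "\<omega> ^ i = \<omega> ^ k" "i \<le> k" for i k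
  proof -
    have "\<omega> ^ (i + (k - i)) = \<omega> ^ i" using that by simp
    then have "\<omega> ^ i * \<omega> ^ (k - i) = \<omega> ^ i" unfolding power_add .
    then have "\<omega> ^ (k - i) = 1" by simp
    then have "N dvd k - i" by (rule \<omega>_power_eq_1)
    then show ?thesis using that(2) by (metis mod_eq_dvd_iff_nat)
  qed
  then show ?thesis using red[of i] red[of k] by (metis nat_le_linear)
qed

lemma \<Gamma>_iff: "z \<in> \<Gamma> j \<longleftrightarrow> z ^ N \<in> complex_of_real ` {a j..b j}"
  by (auto simp: \<Gamma>_def star_set_def N_def)

lemma power_N_rotate: "(\<omega> * z) ^ N = z ^ N"
  by (simp add: power_mult_distrib)

lemma closed_\<Gamma>: "closed (\<Gamma> j)"
proof -
  have "\<Gamma> j = (\<lambda>z. z ^ N) -` (complex_of_real ` {a j..b j})"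
    by (auto simp: \<Gamma>_iff)
  moreover have "closed (complex_of_real ` {a j..b j})"
    by (intro compact_imp_closed compact_continuous_image continuous_intros) auto
  ultimately show ?thesis by (auto intro!: closed_vimage continuous_intros)
qed

lemma compact_\<Gamma>: "compact (\<Gamma> j)"
proof -
  have "norm z \<le> 1 + max \<bar>a j\<bar> \<bar>b j\<bar>" if zG: "z \<in> \<Gamma> j" for z
  proof (cases "norm z \<le> 1")
    case False
    obtain x where x: "x \<in> {a j..b j}" "z ^ N = complex_of_real x" using zG unfolding \<Gamma>_iff by blast
    have "norm z ^ 1 \<le> norm z ^ N"
      using False by (intro power_increasing) (auto simp: N_def)
    also have "\<dots> = \<bar>x\<bar>" by (metis norm_of_real norm_power x(2))
    finally show ?thesis using x(1) by auto
  qed auto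
  then have "bounded (\<Gamma> j)" by (auto simp: bounded_iff)
  then show ?thesis using closed_\<Gamma> by (simp add: compact_eq_bounded_closed)
qed

lemma ab: "j < p \<Longrightarrow> a j < b j" "j < p \<Longrightarrow> 0 \<le> a j \<or> b j \<le> 0"
  using sys by (auto simp: star_system_def split: if_splits)

lemma opposite_signs:
  assumes "Suc j < p"
  shows "0 \<le> a j \<and> b (Suc j) \<le> 0 \<or> b j \<le> 0 \<and> 0 \<le> a (Suc j)"
  using sys assms unfolding star_system_def by (metis Suc_lessD even_Suc)

lemma \<Gamma>_disjoint: "Suc j < p \<Longrightarrow> \<Gamma> j \<inter> \<Gamma> (Suc j) = {}"
  using sys by (auto simp: star_system_def \<Gamma>_def)

text \<open>Consecutive intervals lie on opposite sides of 0 and could meet only there; but then 0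
  would belong to both stars.\<close>

lemma intervals_disjoint:
  assumes "Suc j < p"
  shows "{a j..b j} \<inter> {a (Suc j)..b (Suc j)} = {}"
proof (rule ccontr)
  assume "\<not> ?thesis"
  then obtain x where x: "x \<in> {a j..b j}" "x \<in> {a (Suc j)..b (Suc j)}" by blast
  then have "x = 0" using opposite_signs[OF assms] by auto
  with x have "0 \<in> \<Gamma> i" if "i \<in> {j, Suc j}" for i
    using that unfolding \<Gamma>_iff by (intro image_eqI[where x = 0]) (auto simp: zero_power)
  then have "0 \<in> \<Gamma> j \<inter> \<Gamma> (Suc j)" by simp
  then show False using \<Gamma>_disjoint[OF assms] by blast
qed

lemma \<Gamma>_separated:
  assumes "Suc j < p"
  obtains \<delta> where "\<delta> > 0" "\<And>z t. z \<in> \<Gamma> j \<Longrightarrow> t \<in> \<Gamma> (Suc j) \<Longrightarrow> \<delta> \<le> norm (z - t)"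
  using separate_compact_closed[OF compact_\<Gamma> closed_\<Gamma> \<Gamma>_disjoint[OF assms]]
  by (auto simp: dist_norm)

lemma sets_\<sigma> [measurable_cong]: "j < p \<Longrightarrow> sets (\<sigma> j) = sets borel"
  and finite_\<sigma>: "j < p \<Longrightarrow> finite_measure (\<sigma> j)"
  and distr_rotate: "j < p \<Longrightarrow> distr (\<sigma> j) borel (\<lambda>z. \<omega> * z) = \<sigma> j"
  and infinite_support: "j < p \<Longrightarrow> infinite (measure_support (\<sigma> j))"
  using sys by (auto simp: star_system_def \<omega>_def N_def add.commute)

lemma meas_\<sigma>: "j < p \<Longrightarrow> f \<in> borel_measurable (\<sigma> j) \<longleftrightarrow> f \<in> borel_measurable borel"
  using measurable_cong_sets[OF sets_\<sigma> refl] by blast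

lemma AE_\<Gamma>: assumes "j < p" shows "AE z in \<sigma> j. z \<in> \<Gamma> j"
proof (rule AE_I[where N = "- \<Gamma> j"])
  show "emeasure (\<sigma> j) (- \<Gamma> j) = 0" using sys assms by (auto simp: star_system_def \<Gamma>_def)
  show "- \<Gamma> j \<in> sets (\<sigma> j)" using assms closed_\<Gamma> by (simp add: sets_\<sigma>)
qed auto

lemma integral_rotate:
  fixes f :: "complex \<Rightarrow> complex"
  assumes "j < p" "f \<in> borel_measurable borel"
  shows "(LINT t|\<sigma> j. f (\<omega> * t)) = (LINT t|\<sigma> j. f t)"
proof -
  have "(LINT t|distr (\<sigma> j) borel (\<lambda>z. \<omega> * z). f t) = (LINT t|\<sigma> j. f (\<omega> * t))"
    using assms by (intro integral_distr) (auto simp: meas_\<sigma>)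
  then show ?thesis using distr_rotate[OF assms(1)] by simp
qed

lemma integral_equivariant_eq_0:
  fixes f :: "complex \<Rightarrow> complex"
  assumes "j < p" "f \<in> borel_measurable borel" and eq: "\<And>t. f (\<omega> * t) = c * f t" and "c \<noteq> 1"
  shows "(LINT t|\<sigma> j. f t) = 0"
proof -
  have "c * (LINT t|\<sigma> j. f t) = (LINT t|\<sigma> j. f t)"
    using integral_rotate[OF assms(1,2)] by (simp add: eq)
  then show ?thesis using \<open>c \<noteq> 1\<close> by (metis mult_cancel_right1)
qed

text \<open>
  Conjugation permutes the rotation orbit \<open>{w. w ^ N = t ^ N}\<close> of every \<open>t\<close> in the star, because
  \<open>t ^ N\<close> is real; so averaging over rotations makes a rotation invariant measure conjugation invariant.
\<close>

lemma distr_cnj: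
  assumes j: "j < p"
  shows "distr (\<sigma> j) borel cnj = \<sigma> j"
proof (rule measure_eqI)
  show "sets (distr (\<sigma> j) borel cnj) = sets (\<sigma> j)" using j by (simp add: sets_\<sigma>)
  note [measurable_cong] = sets_\<sigma>[OF j]
  have rot: "(\<integral>\<^sup>+t. f (\<omega> ^ m * t) \<partial>\<sigma> j) = (\<integral>\<^sup>+t. f t \<partial>\<sigma> j)"
    if [measurable]: "f \<in> borel_measurable borel" for f :: "complex \<Rightarrow> ennreal" and m
  proof (induction m)
    case (Suc m)
    have "(\<integral>\<^sup>+t. f (\<omega> ^ m * t) \<partial>\<sigma> j) = (\<integral>\<^sup>+t. f (\<omega> ^ m * t) \<partial>distr (\<sigma> j) borel (\<lambda>z. \<omega> * z))"
      using distr_rotate[OF j] by simp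
    also have "\<dots> = (\<integral>\<^sup>+t. f (\<omega> ^ m * (\<omega> * t)) \<partial>\<sigma> j)"
      by (rule nn_integral_distr) measurable
    finally show ?case using Suc by (simp add: mult_ac)
  qed simp
  have avg: "of_nat N * (\<integral>\<^sup>+t. f t \<partial>\<sigma> j) = (\<integral>\<^sup>+t. (\<Sum>m<N. f (\<omega> ^ m * t)) \<partial>\<sigma> j)"
    if [measurable]: "f \<in> borel_measurable borel" for f :: "complex \<Rightarrow> ennreal"
    by (subst nn_integral_sum) (auto simp: rot)
  fix A assume "A \<in> sets (distr (\<sigma> j) borel cnj)"
  then have [measurable]: "A \<in> sets borel" by simp
  have [measurable]: "cnj \<in> borel_measurable borel"
    by (intro borel_measurable_continuous_onI continuous_intros)
  have "of_nat N * (\<integral>\<^sup>+t. indicator A (cnj t) \<partial>\<sigma> j) = of_nat N * (\<integral>\<^sup>+t. indicator A t \<partial>\<sigma> j)"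
  proof -
    have "of_nat N * (\<integral>\<^sup>+t. indicator A (cnj t) \<partial>\<sigma> j) = (\<integral>\<^sup>+t. (\<Sum>m<N. indicator A (cnj (\<omega> ^ m * t))) \<partial>\<sigma> j)"
      by (rule avg) measurable
    also have "\<dots> = (\<integral>\<^sup>+t. (\<Sum>m<N. indicator A (\<omega> ^ m * t)) \<partial>\<sigma> j)"
    proof (rule nn_integral_cong_AE, use AE_\<Gamma>[OF j] in eventually_elim)
      case (elim t)
      show ?case
      proof (cases "t = 0")
        case False
        have real: "cnj (t ^ N) = t ^ N" using elim unfolding \<Gamma>_iff by (metis complex_cnj_complex_of_real imageE)
        have "(\<Sum>m<N. indicator A (cnj (\<omega> ^ m * t)) :: ennreal) = (\<Sum>w | w ^ N = t ^ N. indicator A (cnj w))"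
          using sum_over_roots[OF N_pos(1), of "\<lambda>w. indicator A (cnj w)" t] False by (simp add: \<omega>_def)
        also have "\<dots> = (\<Sum>w | w ^ N = t ^ N. indicator A w)"
        proof (rule sum.reindex_bij_witness[where i = cnj and j = cnj])
          show "cnj w \<in> {w. w ^ N = t ^ N}" if "w \<in> {w. w ^ N = t ^ N}" for w
            using that real by (metis (mono_tags, lifting) complex_cnj_power mem_Collect_eq)
          then show "cnj w \<in> {w. w ^ N = t ^ N}" if "w \<in> {w. w ^ N = t ^ N}" for w using that .
        qed auto
        also have "\<dots> = (\<Sum>m<N. indicator A (\<omega> ^ m * t))"
          using sum_over_roots[OF N_pos(1), of "indicator A :: complex \<Rightarrow> ennreal" t] False by (simp add: \<omega>_def)
        finally show ?thesis .
      qed simp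
    qed
    also have "\<dots> = of_nat N * (\<integral>\<^sup>+t. indicator A t \<partial>\<sigma> j)"
      by (rule avg[symmetric]) measurable
    finally show ?thesis .
  qed
  then have "(\<integral>\<^sup>+t. indicator A (cnj t) \<partial>\<sigma> j) = (\<integral>\<^sup>+t. indicator A t \<partial>\<sigma> j)"
    by (subst (asm) ennreal_mult_cancel_left) (auto simp: of_nat_eq_0_iff)
  moreover have "(\<integral>\<^sup>+t. indicator A t \<partial>distr (\<sigma> j) borel cnj) = (\<integral>\<^sup>+t. indicator A (cnj t) \<partial>\<sigma> j)"
    by (rule nn_integral_distr) measurable
  ultimately show "emeasure (distr (\<sigma> j) borel cnj) A = emeasure (\<sigma> j) A"
    using j by (simp add: sets_\<sigma>)
qed

lemma integral_cnj_arg: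
  fixes f :: "complex \<Rightarrow> complex"
  assumes "j < p" "f \<in> borel_measurable borel"
  shows "(LINT t|\<sigma> j. f (cnj t)) = (LINT t|\<sigma> j. f t)"
proof -
  have "cnj \<in> borel_measurable borel"
    by (intro borel_measurable_continuous_onI continuous_intros)
  then have "(LINT t|distr (\<sigma> j) borel cnj. f t) = (LINT t|\<sigma> j. f (cnj t))"
    using assms by (intro integral_distr) (auto simp: meas_\<sigma>)
  then show ?thesis using distr_cnj[OF assms(1)] by simp
qed

lemma measurable_Cauchy_transform:
  assumes "j < p" and [measurable]: "f \<in> borel_measurable borel"
  shows "(\<lambda>z. LINT t|\<sigma> j. f t / (z - t)) \<in> borel_measurable borel"
proof -
  interpret finite_measure "\<sigma> j" by (rule finite_\<sigma>) fact
  note [measurable_cong] = sets_\<sigma>[OF assms(1)]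
  show ?thesis by measurable
qed

text \<open>The bound also covers a non-integrable integrand, whose integral is 0 by convention;
  \<open>max B 0\<close> keeps the right-hand side nonnegative.\<close>

lemma Cauchy_transform_bound:
  assumes j: "j < p" and bnd: "\<And>t. t \<in> \<Gamma> j \<Longrightarrow> norm (f t) \<le> B"
    and \<delta>: "\<delta> > 0" "\<And>t. t \<in> \<Gamma> j \<Longrightarrow> \<delta> \<le> norm (z - t)"
  shows "norm (LINT t|\<sigma> j. f t / (z - t)) \<le> (max B 0 / \<delta>) * measure (\<sigma> j) (space (\<sigma> j))"
proof (cases "integrable (\<sigma> j) (\<lambda>t. f t / (z - t))")
  case True
  interpret finite_measure "\<sigma> j" by (rule finite_\<sigma>) fact
  have "norm (LINT t|\<sigma> j. f t / (z - t)) \<le> (LINT t|\<sigma> j. max B 0 / \<delta>)"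
  proof -
    have "norm (LINT t|\<sigma> j. f t / (z - t)) \<le> (LINT t|\<sigma> j. norm (f t / (z - t)))"
      by (rule integral_norm_bound)
    also have "\<dots> \<le> (LINT t|\<sigma> j. max B 0 / \<delta>)"
    proof (rule integral_mono_AE')
      show "AE t in \<sigma> j. norm (f t / (z - t)) \<le> max B 0 / \<delta>"
        using AE_\<Gamma>[OF j]
      proof eventually_elim
        case (elim t)
        show ?case unfolding norm_divide
          using bnd[OF elim] \<delta>(1) \<delta>(2)[OF elim] by (intro frac_le) auto
      qed
    qed (use \<delta>(1) in auto)
    finally show ?thesis .
  qed
  then show ?thesis by (simp add: mult.commute)
next
  case False
  then show ?thesis using \<delta> by (simp add: not_integrable_integral_eq)
qed

section \<open>The multi-orthogonal polynomials\<close>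

lemma measurable_nikishin_density: "j < p \<Longrightarrow> nikishin_density \<sigma> k j \<in> borel_measurable borel"
proof (induction "j - k" arbitrary: k)
  case 0
  then have "nikishin_density \<sigma> k j = (\<lambda>z. 1)"
    by (intro ext) (simp add: nikishin_density.simps)
  then show ?case by simp
next
  case (Suc m)
  then have "k < j" by simp
  then have "nikishin_density \<sigma> k j = (\<lambda>z. LINT t|\<sigma> (Suc k). nikishin_density \<sigma> (Suc k) j t / (z - t))"
    by (intro ext) (subst nikishin_density.simps, simp)
  moreover have "nikishin_density \<sigma> (Suc k) j \<in> borel_measurable borel"
    using Suc by (intro Suc.hyps(1)) auto
  ultimately show ?case
    using measurable_Cauchy_transform[of "Suc k"] Suc.prems \<open>k < j\<close> by simp
qed

lemma nikishin_density_bounded: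
  "k \<le> j \<Longrightarrow> j < p \<Longrightarrow> \<exists>B. \<forall>z\<in>\<Gamma> k. norm (nikishin_density \<sigma> k j z) \<le> B"
proof (induction "j - k" arbitrary: k)
  case 0
  then show ?case by (intro exI[of _ 1]) (simp add: nikishin_density.simps)
next
  case (Suc m)
  then have kj: "k < j" by simp
  have "\<exists>B. \<forall>z\<in>\<Gamma> (Suc k). norm (nikishin_density \<sigma> (Suc k) j z) \<le> B"
    using Suc kj by (intro Suc.hyps(1)) auto
  then obtain B where B: "\<And>z. z \<in> \<Gamma> (Suc k) \<Longrightarrow> norm (nikishin_density \<sigma> (Suc k) j z) \<le> B" by blast
  obtain \<delta> where \<delta>: "\<delta> > 0" "\<And>z t. z \<in> \<Gamma> k \<Longrightarrow> t \<in> \<Gamma> (Suc k) \<Longrightarrow> \<delta> \<le> norm (z - t)"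
    using \<Gamma>_separated[of k] Suc.prems kj by auto
  have "norm (nikishin_density \<sigma> k j z) \<le> (max B 0 / \<delta>) * measure (\<sigma> (Suc k)) (space (\<sigma> (Suc k)))"
    if "z \<in> \<Gamma> k" for z
  proof -
    have "nikishin_density \<sigma> k j z = (LINT t|\<sigma> (Suc k). nikishin_density \<sigma> (Suc k) j t / (z - t))"
      using kj by (subst nikishin_density.simps) simp
    then show ?thesis
      using Cauchy_transform_bound[OF _ B \<delta>(1) \<delta>(2)[OF that]] Suc.prems kj by simp
  qed
  then show ?case by blast
qed

text \<open>Each Cauchy kernel between levels \<open>k\<close> and \<open>j\<close> contributes one
  inverse factor \<open>\<omega>\<close>; these factors are moved to the left to avoid negative
  exponents.\<close>

lemma nikishin_density_rotate:
  "k \<le> j \<Longrightarrow> j < p \<Longrightarrow> nikishin_density \<sigma> k j (\<omega> * z) * \<omega> ^ (j - k) = nikishin_density \<sigma> k j z"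
proof (induction "j - k" arbitrary: k z)
  case 0
  then show ?case by (simp add: nikishin_density.simps)
next
  case (Suc m)
  then have kj: "k < j" by simp
  let ?D = "nikishin_density \<sigma> (Suc k) j"
  have IH: "?D (\<omega> * t) * \<omega> ^ (j - Suc k) = ?D t" for t
    using Suc kj by (intro Suc.hyps(1)) auto
  have step: "nikishin_density \<sigma> k j z = (LINT t|\<sigma> (Suc k). ?D t / (z - t))" for z
    using kj by (subst nikishin_density.simps) simp
  have [measurable]: "?D \<in> borel_measurable borel"
    using measurable_nikishin_density Suc.prems by blast
  have "nikishin_density \<sigma> k j (\<omega> * z) * \<omega> ^ (j - k) =
      (LINT t|\<sigma> (Suc k). ?D (\<omega> * t) / (\<omega> * z - \<omega> * t)) * \<omega> ^ (j - k)"
    unfolding step using kj Suc.prems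
    by (subst integral_rotate[symmetric]) auto
  also have "\<dots> = (LINT t|\<sigma> (Suc k). ?D (\<omega> * t) / (\<omega> * z - \<omega> * t) * \<omega> ^ (j - k))"
    by (rule integral_mult_left_zero[symmetric])
  also have "\<dots> = (LINT t|\<sigma> (Suc k). ?D t / (z - t))"
  proof (rule Bochner_Integration.integral_cong[OF refl])
    fix t
    have "\<omega> ^ (j - k) = \<omega> * \<omega> ^ (j - Suc k)"
      using kj by (metis Suc_diff_Suc power_Suc)
    then have "?D (\<omega> * t) / (\<omega> * z - \<omega> * t) * \<omega> ^ (j - k) =
       \<omega> * (?D (\<omega> * t) * \<omega> ^ (j - Suc k)) / (\<omega> * (z - t))"
      by (simp add: algebra_simps)
    also have "\<dots> = ?D t / (z - t)" unfolding IH by simp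
    finally show "?D (\<omega> * t) / (\<omega> * z - \<omega> * t) * \<omega> ^ (j - k) = ?D t / (z - t)" .
  qed
  finally show ?case unfolding step .
qed

lemma nikishin_density_cnj:
  "k \<le> j \<Longrightarrow> j < p \<Longrightarrow> nikishin_density \<sigma> k j (cnj z) = cnj (nikishin_density \<sigma> k j z)"
proof (induction "j - k" arbitrary: k z)
  case 0
  then show ?case by (simp add: nikishin_density.simps)
next
  case (Suc m)
  then have kj: "k < j" by simp
  let ?D = "nikishin_density \<sigma> (Suc k) j"
  have IH: "?D (cnj t) = cnj (?D t)" for t
    using Suc kj by (intro Suc.hyps(1)) auto
  have step: "nikishin_density \<sigma> k j z = (LINT t|\<sigma> (Suc k). ?D t / (z - t))" for z
    using kj by (subst nikishin_density.simps) simp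
  have [measurable]: "?D \<in> borel_measurable borel"
    using measurable_nikishin_density Suc.prems by blast
  have "nikishin_density \<sigma> k j (cnj z) = (LINT t|\<sigma> (Suc k). ?D (cnj t) / (cnj z - cnj t))"
    unfolding step using kj Suc.prems by (subst integral_cnj_arg[symmetric]) auto
  also have "\<dots> = (LINT t|\<sigma> (Suc k). cnj (?D t / (z - t)))"
    by (simp add: IH)
  also have "\<dots> = cnj (LINT t|\<sigma> (Suc k). ?D t / (z - t))"
    by (rule Bochner_Integration.integral_cnj)
  finally show ?case unfolding step .
qed

lemma integrable_bounded_on_\<Gamma>:
  fixes f :: "complex \<Rightarrow> complex"
  assumes "j < p" "f \<in> borel_measurable borel" "\<And>t. t \<in> \<Gamma> j \<Longrightarrow> norm (f t) \<le> B"
  shows "integrable (\<sigma> j) f"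
proof -
  interpret finite_measure "\<sigma> j" by (rule finite_\<sigma>) fact
  show ?thesis
  proof (rule integrable_const_bound)
    show "AE t in \<sigma> j. norm (f t) \<le> B" using AE_\<Gamma>[OF assms(1)] by eventually_elim (rule assms(3))
  qed (use assms in \<open>simp add: meas_\<sigma>\<close>)
qed

text \<open>Division with remainder by \<open>p\<close> lists the pairs (power, measure) in one
  sequence, \<open>i = p * s + j\<close>. In this order the conditions imposed on the polynomial of
  index \<open>n\<close> are exactly those with \<open>i < n\<close>.\<close>

definition orth :: "nat \<Rightarrow> complex poly \<Rightarrow> complex" where
  "orth i P = nikishin_integral \<sigma> 0 (i mod p) (\<lambda>z. poly P z * z ^ (i div p))"

lemma poly_measurable [measurable]: "(\<lambda>z. poly P z) \<in> borel_measurable borel" for P :: "complex poly"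
  by (intro borel_measurable_continuous_onI continuous_intros)

lemma poly_bounded_on_\<Gamma>: "\<exists>B. \<forall>z\<in>\<Gamma> j. norm (poly P z) \<le> B"
proof -
  have "bounded (poly P ` \<Gamma> j)"
    by (intro compact_imp_bounded compact_continuous_image compact_\<Gamma> continuous_intros)
  then show ?thesis by (auto simp: bounded_iff)
qed

lemma integrable_orth:
  assumes "j < p"
  shows "integrable (\<sigma> 0) (\<lambda>z. poly P z * z ^ s * nikishin_density \<sigma> 0 j z)"
proof -
  obtain B where B: "\<And>z. z \<in> \<Gamma> 0 \<Longrightarrow> norm (poly (P * monom 1 s) z) \<le> B"
    using poly_bounded_on_\<Gamma> by blast
  obtain C where C: "\<And>z. z \<in> \<Gamma> 0 \<Longrightarrow> norm (nikishin_density \<sigma> 0 j z) \<le> C"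
    using nikishin_density_bounded assms by blast
  have [measurable]: "nikishin_density \<sigma> 0 j \<in> borel_measurable borel"
    using measurable_nikishin_density assms by blast
  show ?thesis
  proof (rule integrable_bounded_on_\<Gamma>[where B = "B * C"])
    fix z assume z: "z \<in> \<Gamma> 0"
    show "norm (poly P z * z ^ s * nikishin_density \<sigma> 0 j z) \<le> B * C"
      unfolding norm_mult[of "poly P z * z ^ s"]
      using B[OF z] C[OF z] by (intro mult_mono) (auto simp: poly_monom intro: order_trans[OF norm_ge_zero])
  qed (use p_pos in auto)
qed

lemma orth_add: "orth i (P + Q) = orth i P + orth i Q"
  using integrable_orth[of "i mod p" _ "i div p"] p_pos
  by (simp add: orth_def nikishin_integral_def distrib_right)

lemma orth_smult: "orth i (smult c P) = c * orth i P"
  by (simp add: orth_def nikishin_integral_def mult.assoc)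

lemma le_floor_iff_nat:
  "int s \<le> \<lfloor>(real n - real j - 1) / real p\<rfloor> \<longleftrightarrow> p * s + j < n"
proof -
  have "int s \<le> \<lfloor>(real n - real j - 1) / real p\<rfloor> \<longleftrightarrow> real s * real p \<le> real n - real j - 1"
    using p_pos by (simp add: le_floor_iff pos_le_divide_eq)
  also have "\<dots> \<longleftrightarrow> real (p * s + j + 1) \<le> real n" by (simp add: algebra_simps)
  also have "\<dots> \<longleftrightarrow> p * s + j < n" unfolding of_nat_le_iff by linarith
  finally show ?thesis .
qed

lemma multi_orthogonal_iff: "multi_orthogonal p \<sigma> n P \<longleftrightarrow> (\<forall>i<n. orth i P = 0)"
proof
  assume "multi_orthogonal p \<sigma> n P"
  then show "\<forall>i<n. orth i P = 0"
    unfolding multi_orthogonal_def le_floor_iff_nat orth_def using p_pos by simp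
next
  assume *: "\<forall>i<n. orth i P = 0"
  show "multi_orthogonal p \<sigma> n P"
    unfolding multi_orthogonal_def le_floor_iff_nat
  proof (intro allI impI)
    fix j s assume "j < p" "p * s + j < n"
    then show "nikishin_integral \<sigma> 0 j (\<lambda>z. poly P z * z ^ s) = 0"
      using * unfolding orth_def by (auto dest: spec[of _ "p * s + j"])
  qed
qed

abbreviation is_mop :: "nat \<Rightarrow> complex poly \<Rightarrow> bool" where
  "is_mop n P \<equiv> lead_coeff P = 1 \<and> multi_orthogonal p \<sigma> n P \<and>
     (\<forall>R. lead_coeff R = 1 \<and> multi_orthogonal p \<sigma> n R \<longrightarrow> degree P \<le> degree R)"

text \<open>There are \<open>n\<close> linear conditions, and \<open>n + 1\<close> degrees from 0 to
  \<open>n\<close> are available.\<close>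

lemma exists_orthogonal: "\<exists>P. lead_coeff P = 1 \<and> multi_orthogonal p \<sigma> n P \<and> degree P \<le> n"
proof -
  have "\<exists>Q\<in>UNIV. Q \<noteq> 0 \<and> degree Q \<in> {..n} \<and> (\<forall>i<n. orth i Q = 0)"
    by (rule exists_poly_in_common_kernel[where f = "\<lambda>d. monom 1 d"])
      (auto simp: orth_add orth_smult degree_monom_eq)
  then obtain Q where Q: "Q \<noteq> 0" "degree Q \<le> n" "\<And>i. i < n \<Longrightarrow> orth i Q = 0" by auto
  then show ?thesis
    by (intro exI[of _ "smult (inverse (lead_coeff Q)) Q"])
      (auto simp: multi_orthogonal_iff orth_smult)
qed

text \<open>Leading terms cancel in the difference of two minimal solutions; once normalised, a
  nonzero difference would be a solution of smaller degree.\<close>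

lemma is_mop_unique:
  assumes "is_mop n P" "is_mop n Q"
  shows "P = Q"
proof (rule ccontr)
  assume "P \<noteq> Q"
  define R where "R = P + smult (-1) Q"
  have R0: "R \<noteq> 0" using \<open>P \<noteq> Q\<close> by (simp add: R_def)
  have deg: "degree P = degree Q" using assms by (meson order_antisym)
  have "degree R < degree P"
  proof -
    have "degree R \<le> degree P" unfolding R_def using deg by (intro degree_add_le) auto
    moreover have "coeff R (degree P) = 0" unfolding R_def using assms deg by simp
    ultimately show ?thesis using R0 by (metis leading_coeff_0_iff nat_less_le)
  qed
  moreover have "multi_orthogonal p \<sigma> n (smult (inverse (lead_coeff R)) R)"
    using assms unfolding multi_orthogonal_iff R_def by (simp add: orth_smult orth_add del: smult_minus_left smult_1_left)
  moreover have "lead_coeff (smult (inverse (lead_coeff R)) R) = 1" using R0 by simp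
  ultimately show False using assms(1) R0
    by (metis degree_smult_eq inverse_nonzero_iff_nonzero leD leading_coeff_0_iff)
qed

lemma is_mop_mop: "is_mop n (mop p \<sigma> n)"
proof -
  obtain P where "lead_coeff P = 1 \<and> multi_orthogonal p \<sigma> n P"
    using exists_orthogonal by blast
  from ex_has_least_nat[of "\<lambda>P. lead_coeff P = 1 \<and> multi_orthogonal p \<sigma> n P", OF this, of degree]
  obtain P where "is_mop n P" by blast
  then have "\<exists>!P. is_mop n P" using is_mop_unique by blast
  then show ?thesis unfolding mop_def by (rule theI')
qed

text \<open>The device for symmetries: a transformation that keeps degree, leading coefficient 1 and
  orthogonality must fix the polynomial.\<close>

lemma mop_eqI:
  assumes "lead_coeff P = 1" "multi_orthogonal p \<sigma> n P" "degree P = degree (mop p \<sigma> n)"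
  shows "P = mop p \<sigma> n"
  using assms is_mop_mop[of n] by (intro is_mop_unique) auto

lemma degree_mop_le: "degree (mop p \<sigma> n) \<le> n"
  using is_mop_mop[of n] exists_orthogonal[of n] by (meson order_trans)

lemma mop_nz: "mop p \<sigma> n \<noteq> 0"
  using is_mop_mop[of n] by auto

text \<open>Rotation changes each functional only by a root of unity, one part from the power and
  one from the density. Vanishing of the functional is therefore preserved.\<close>

lemma orth_rotate: "orth i (pcompose P [:0, \<omega>:]) * \<omega> ^ (i div p) = \<omega> ^ (i mod p) * orth i P"
proof -
  let ?D = "nikishin_density \<sigma> 0 (i mod p)"
  have j: "i mod p < p" using p_pos by simp
  have [measurable]: "?D \<in> borel_measurable borel"
    using measurable_nikishin_density j by blast
  have D: "?D t = ?D (\<omega> * t) * \<omega> ^ (i mod p)" for t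
    using nikishin_density_rotate[OF _ j, of 0 t] by simp
  have "orth i (pcompose P [:0, \<omega>:]) * \<omega> ^ (i div p) =
      (LINT t|\<sigma> 0. poly P (\<omega> * t) * t ^ (i div p) * ?D t * \<omega> ^ (i div p))"
    unfolding orth_def nikishin_integral_def
    by (subst integral_mult_left_zero[symmetric]) (simp add: poly_pcompose mult_ac)
  also have "\<dots> = (LINT t|\<sigma> 0. \<omega> ^ (i mod p) * (poly P (\<omega> * t) * (\<omega> * t) ^ (i div p) * ?D (\<omega> * t)))"
    by (rule Bochner_Integration.integral_cong[OF refl], subst D) (simp add: power_mult_distrib mult_ac)
  also have "\<dots> = \<omega> ^ (i mod p) * (LINT t|\<sigma> 0. poly P (\<omega> * t) * (\<omega> * t) ^ (i div p) * ?D (\<omega> * t))"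
    by (rule integral_mult_right_zero)
  also have "(LINT t|\<sigma> 0. poly P (\<omega> * t) * (\<omega> * t) ^ (i div p) * ?D (\<omega> * t)) =
     (LINT t|\<sigma> 0. poly P t * t ^ (i div p) * ?D t)"
    using p_pos by (intro integral_rotate[where f = "\<lambda>t. poly P t * t ^ (i div p) * ?D t"]) measurable
  finally show ?thesis unfolding orth_def nikishin_integral_def .
qed

lemma orth_cnj: "orth i (map_poly cnj P) = cnj (orth i P)"
proof -
  let ?D = "nikishin_density \<sigma> 0 (i mod p)"
  have j: "i mod p < p" using p_pos by simp
  have [measurable]: "?D \<in> borel_measurable borel"
    using measurable_nikishin_density j by blast
  define F where "F = (\<lambda>z. poly (map_poly cnj P) z * z ^ (i div p) * ?D z)"
  have "F \<in> borel_measurable borel"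
    unfolding F_def using \<open>?D \<in> _\<close>
    by (intro borel_measurable_times borel_measurable_power poly_measurable) auto
  from integral_cnj_arg[OF p_pos this, symmetric]
  have "orth i (map_poly cnj P) = (LINT t|\<sigma> 0. poly (map_poly cnj P) (cnj t) * cnj t ^ (i div p) * ?D (cnj t))"
    unfolding orth_def nikishin_integral_def F_def .
  also have "\<dots> = (LINT t|\<sigma> 0. cnj (poly P t * t ^ (i div p) * ?D t))"
    using j by (simp add: nikishin_density_cnj)
  also have "\<dots> = cnj (orth i P)"
    unfolding orth_def nikishin_integral_def by (rule Bochner_Integration.integral_cnj)
  finally show ?thesis .
qed

lemma mop_rotate: "pcompose (mop p \<sigma> n) [:0, \<omega>:] = smult (\<omega> ^ degree (mop p \<sigma> n)) (mop p \<sigma> n)"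
proof -
  let ?Q = "mop p \<sigma> n" and ?d = "degree (mop p \<sigma> n)"
  let ?R = "smult (inverse (\<omega> ^ ?d)) (pcompose ?Q [:0, \<omega>:])"
  have "?R = ?Q"
  proof (rule mop_eqI)
    have "lead_coeff (pcompose ?Q [:0, \<omega>:]) = \<omega> ^ ?d"
      using lead_coeff_comp[of "[:0, \<omega>:]" ?Q] is_mop_mop[of n] by simp
    then show "lead_coeff ?R = 1" by simp
    show "degree ?R = ?d" by (simp add: degree_pcompose)
    have "orth i ?Q = 0" if "i < n" for i using is_mop_mop[of n] that by (simp add: multi_orthogonal_iff)
    then show "multi_orthogonal p \<sigma> n ?R"
      unfolding multi_orthogonal_iff orth_smult
    proof (intro allI impI)
      fix i assume "i < n"
      with \<open>\<And>i. i < n \<Longrightarrow> orth i ?Q = 0\<close> have "orth i (pcompose ?Q [:0, \<omega>:]) * \<omega> ^ (i div p) = 0"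
        using orth_rotate[of i ?Q] by simp
      then show "inverse (\<omega> ^ ?d) * orth i (pcompose ?Q [:0, \<omega>:]) = 0" by simp
    qed
  qed
  then have "smult (\<omega> ^ ?d) ?R = smult (\<omega> ^ ?d) ?Q" by (rule arg_cong)
  then show ?thesis by simp
qed

lemma mop_cnj: "map_poly cnj (mop p \<sigma> n) = mop p \<sigma> n"
proof (rule mop_eqI)
  show "degree (map_poly cnj (mop p \<sigma> n)) = degree (mop p \<sigma> n)" by (simp add: degree_map_poly)
  then show "lead_coeff (map_poly cnj (mop p \<sigma> n)) = 1"
    using is_mop_mop[of n] by (simp add: coeff_map_poly)
  show "multi_orthogonal p \<sigma> n (map_poly cnj (mop p \<sigma> n))"
    using is_mop_mop[of n] by (simp add: multi_orthogonal_iff orth_cnj)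
qed

end

section \<open>The functions of the second kind\<close>

locale star_nikishin_index = star_nikishin +
  fixes n :: nat
begin

definition Q :: "complex poly" where "Q = mop p \<sigma> n"
definition l :: nat where "l = degree Q mod N"
definition R :: "complex poly" where "R = reduced_mop p \<sigma> n l"
definition \<Psi> :: "nat \<Rightarrow> complex \<Rightarrow> complex" where "\<Psi> k = second_kind p \<sigma> n k"
definition \<psi> :: "nat \<Rightarrow> complex \<Rightarrow> complex" where "\<psi> k = reduced_second_kind p \<sigma> n l k"
text \<open>This is the ceiling of \<open>(l - k) / (p + 1)\<close>, the lower limit in
  \<open>M_count\<close>, for \<open>k < p\<close>. The same number is the exponent of the extra
  \<open>t ^ N\<close> that remains in the integral for \<open>\<psi> (k + 1)\<close>.\<close>

definition \<epsilon> :: "nat \<Rightarrow> nat" where "\<epsilon> k = (if k < l then 1 else 0)"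

lemma l_less: "l < N" by (simp add: l_def)

text \<open>By \<open>mop_rotate\<close>, \<open>Q\<close> is an eigenvector of the rotation, while
  each monomial has its own eigenvalue depending on the exponent modulo \<open>N\<close>.\<close>

lemma coeff_Q_eq_0:
  assumes "i mod N \<noteq> l"
  shows "coeff Q i = 0"
proof -
  have "coeff (pcompose Q [:0, \<omega>:]) i = \<omega> ^ i * coeff Q i"
    by (rule coeff_pcompose_linear)
  then have "\<omega> ^ i * coeff Q i = \<omega> ^ degree Q * coeff Q i"
    unfolding Q_def mop_rotate by auto
  moreover have "\<omega> ^ i \<noteq> \<omega> ^ degree Q"
    using assms \<omega>_power_eq_iff by (simp add: l_def)
  ultimately show ?thesis by simp
qed

text \<open>\<open>R0\<close> collects every \<open>N\<close>-th coefficient of \<open>Q\<close>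
  from index \<open>l\<close> on; the others vanish. It is the only polynomial that the description
  \<open>reduced_mop\<close> can denote, since composition with a monomial of positive degree is
  injective.\<close>

lemma reduced_mop_works:
  shows Q_eq: "Q = monom 1 l * pcompose R (monom 1 N)"
    and coeff_R_real: "coeff R i \<in> \<real>"
proof -
  define R0 where "R0 = (\<Sum>i\<le>degree Q div N. monom (coeff Q (l + N * i)) i)"
  have Q0: "Q = monom 1 l * pcompose R0 (monom 1 N)"
  proof (rule poly_eq_poly_eq_iff[THEN iffD1], rule ext)
    fix z
    have "poly Q z = (\<Sum>m\<le>degree Q. coeff Q m * z ^ m)" by (rule poly_altdef)
    also have "\<dots> = (\<Sum>m\<in>(\<lambda>i. l + N * i) ` {..degree Q div N}. coeff Q m * z ^ m)"
    proof (rule sum.mono_neutral_right)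
      have "l + N * i \<le> degree Q" if "i \<le> degree Q div N" for i
      proof -
        have "N * i \<le> N * (degree Q div N)" using that by (rule mult_le_mono2)
        then have "l + N * i \<le> degree Q mod N + N * (degree Q div N)" unfolding l_def by (rule add_left_mono)
        also have "\<dots> = degree Q" by (rule mod_mult_div_eq)
        finally show ?thesis .
      qed
      then show "(\<lambda>i. l + N * i) ` {..degree Q div N} \<subseteq> {..degree Q}" by auto
      have "m \<in> (\<lambda>i. l + N * i) ` {..degree Q div N}" if "m \<le> degree Q" "m mod N = l" for m
      proof (rule image_eqI[of _ _ "m div N"])
        show "m = l + N * (m div N)" using that(2) mod_mult_div_eq[of m N] by simp
      qed (use that in \<open>auto intro: div_le_mono\<close>)
      then show "\<forall>m\<in>{..degree Q} - (\<lambda>i. l + N * i) ` {..degree Q div N}. coeff Q m * z ^ m = 0"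
        using coeff_Q_eq_0 by fastforce
    qed simp
    also have "\<dots> = (\<Sum>i\<le>degree Q div N. coeff Q (l + N * i) * z ^ (l + N * i))"
      by (subst sum.reindex) (auto intro!: inj_onI)
    also have "\<dots> = poly (monom 1 l * pcompose R0 (monom 1 N)) z"
    proof -
      have "z ^ (l + N * i) = z ^ l * (z ^ N) ^ i" for i by (simp only: power_add power_mult)
      then show ?thesis
        by (simp add: R0_def poly_pcompose poly_monom poly_sum sum_distrib_left mult_ac)
    qed
    finally show "poly Q z = poly (monom 1 l * pcompose R0 (monom 1 N)) z" .
  qed
  have R0: "R = R0"
    unfolding R_def reduced_mop_def
  proof (rule the_equality)
    show "mop p \<sigma> n = monom 1 l * pcompose R0 (monom 1 (p + 1))"
      using Q0 by (simp add: Q_def N_def)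
    fix R1 assume "mop p \<sigma> n = monom 1 l * pcompose R1 (monom 1 (p + 1))"
    then have "monom 1 l * pcompose R1 (monom 1 N) = monom 1 l * pcompose R0 (monom 1 N)"
      using Q0 by (simp add: Q_def N_def)
    then have "pcompose (R1 - R0) (monom 1 N) = 0"
      by (simp add: pcompose_diff monom_eq_0_iff)
    then have "R1 - R0 = 0" by (rule pcompose_eq_0) (simp add: degree_monom_eq)
    then show "R1 = R0" by simp
  qed
  show "Q = monom 1 l * pcompose R (monom 1 N)" using Q0 R0 by simp
  have "coeff Q m \<in> \<real>" for m
  proof -
    have "cnj (coeff Q m) = coeff (map_poly cnj Q) m" by (simp add: coeff_map_poly)
    then show ?thesis unfolding Q_def mop_cnj by (simp add: Reals_cnj_iff)
  qed
  then show "coeff R i \<in> \<real>"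
    unfolding R0 R0_def by (auto simp: coeff_sum intro!: sum_in_Reals)
qed

lemma R_nz: "R \<noteq> 0"
  using mop_nz[of n] Q_eq by (auto simp: Q_def)

lemma degree_Q: "degree Q = l + N * degree R"
proof -
  have "pcompose R (monom 1 N) \<noteq> 0"
    using Q_eq mop_nz[of n] by (auto simp: Q_def)
  then show ?thesis
    by (subst Q_eq) (simp add: degree_mult_eq degree_monom_eq degree_pcompose monom_eq_0_iff)
qed

lemma poly_Q: "poly Q z = z ^ l * poly R (z ^ N)"
  by (subst Q_eq) (simp add: poly_pcompose poly_monom)

lemma \<Psi>_0: "\<Psi> 0 z = poly Q z" and \<Psi>_Suc: "\<Psi> (Suc k) z = (LINT t|\<sigma> k. \<Psi> k t / (z - t))"
  by (simp_all add: \<Psi>_def Q_def)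

lemma measurable_\<Psi>: "k \<le> p \<Longrightarrow> \<Psi> k \<in> borel_measurable borel"
proof (induction k)
  case 0
  then show ?case by (simp add: \<Psi>_0[abs_def])
next
  case (Suc k)
  then show ?case unfolding \<Psi>_Suc[abs_def] by (intro measurable_Cauchy_transform) auto
qed

lemma \<Psi>_bounded: "k < p \<Longrightarrow> \<exists>B. \<forall>z\<in>\<Gamma> k. norm (\<Psi> k z) \<le> B"
proof (induction k)
  case 0
  show ?case unfolding \<Psi>_0 by (rule poly_bounded_on_\<Gamma>)
next
  case (Suc k)
  then obtain B where B: "\<And>z. z \<in> \<Gamma> k \<Longrightarrow> norm (\<Psi> k z) \<le> B" by auto
  obtain \<delta> where \<delta>: "\<delta> > 0" "\<And>z t. z \<in> \<Gamma> k \<Longrightarrow> t \<in> \<Gamma> (Suc k) \<Longrightarrow> \<delta> \<le> norm (z - t)"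
    using \<Gamma>_separated[of k] Suc.prems by auto
  have "norm (\<Psi> (Suc k) z) \<le> (max B 0 / \<delta>) * measure (\<sigma> k) (space (\<sigma> k))" if "z \<in> \<Gamma> (Suc k)" for z
    unfolding \<Psi>_Suc using Suc.prems that \<delta>
    by (intro Cauchy_transform_bound B) (auto simp: norm_minus_commute)
  then show ?case by blast
qed

lemma \<Psi>_rotate: "k \<le> p \<Longrightarrow> \<Psi> k (\<omega> * z) * \<omega> ^ k = \<omega> ^ l * \<Psi> k z"
proof (induction k arbitrary: z)
  case 0
  show ?case by (simp add: \<Psi>_0 poly_Q power_mult_distrib)
next
  case (Suc k)
  have [measurable]: "\<Psi> k \<in> borel_measurable borel" using measurable_\<Psi> Suc by simp
  have "\<Psi> (Suc k) (\<omega> * z) = (LINT t|\<sigma> k. \<Psi> k (\<omega> * t) / (\<omega> * z - \<omega> * t))"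
    unfolding \<Psi>_Suc using Suc.prems by (subst integral_rotate[symmetric]) auto
  then have "\<Psi> (Suc k) (\<omega> * z) * \<omega> ^ Suc k = (LINT t|\<sigma> k. \<Psi> k (\<omega> * t) / (\<omega> * z - \<omega> * t) * \<omega> ^ Suc k)"
    by (simp only: integral_mult_left_zero)
  also have "\<dots> = (LINT t|\<sigma> k. \<omega> ^ l * (\<Psi> k t / (z - t)))"
  proof (rule Bochner_Integration.integral_cong[OF refl])
    fix t
    have "\<Psi> k (\<omega> * t) / (\<omega> * z - \<omega> * t) * \<omega> ^ Suc k = \<omega> * (\<Psi> k (\<omega> * t) * \<omega> ^ k) / (\<omega> * (z - t))"
      by (simp add: algebra_simps)
    also have "\<dots> = \<omega> ^ l * (\<Psi> k t / (z - t))"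
      using Suc.IH[of t] Suc.prems by simp
    finally show "\<Psi> k (\<omega> * t) / (\<omega> * z - \<omega> * t) * \<omega> ^ Suc k = \<omega> ^ l * (\<Psi> k t / (z - t))" .
  qed
  also have "\<dots> = \<omega> ^ l * \<Psi> (Suc k) z" unfolding \<Psi>_Suc by (rule integral_mult_right_zero)
  finally show ?case .
qed

section \<open>Reduced functions and their relation to the functions of the second kind\<close>

lemma \<psi>_0: "\<psi> 0 z = poly R z"
  by (simp add: \<psi>_def reduced_second_kind_def R_def)

lemma \<psi>_Suc_le: "l \<le> k \<Longrightarrow> \<psi> (Suc k) z = z * (LINT t|\<sigma> k. \<Psi> k t * t ^ (k - l) / (z - t ^ N))"
  by (simp add: \<psi>_def reduced_second_kind_def \<Psi>_def N_def del: power_Suc)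

lemma \<psi>_Suc_gt: "k < l \<Longrightarrow> \<psi> (Suc k) z = (LINT t|\<sigma> k. \<Psi> k t * t ^ (N + k - l) / (z - t ^ N))"
  by (simp add: \<psi>_def reduced_second_kind_def \<Psi>_def N_def del: power_Suc)

lemma power_N_separated:
  assumes "z \<notin> complex_of_real ` {a k..b k}"
  obtains \<delta> where "\<delta> > 0" "\<And>t. t \<in> \<Gamma> k \<Longrightarrow> \<delta> \<le> norm (z - t ^ N)"
proof -
  have "closed (complex_of_real ` {a k..b k})"
    by (intro compact_imp_closed compact_continuous_image continuous_intros) auto
  then obtain d where "d > 0" "\<And>x. x \<in> complex_of_real ` {a k..b k} \<Longrightarrow> d \<le> dist z x"
    using separate_point_closed[OF _ assms] by blast
  then show ?thesis using that[of d] unfolding \<Gamma>_iff dist_norm by blast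
qed

lemma \<Psi>_power_bounded:
  assumes "k < p"
  shows "\<exists>B\<ge>0. \<forall>t\<in>\<Gamma> k. norm (\<Psi> k t * t ^ i) \<le> B"
proof -
  obtain B where B: "\<And>t. t \<in> \<Gamma> k \<Longrightarrow> norm (\<Psi> k t) \<le> B" using \<Psi>_bounded assms by blast
  obtain C where C: "\<And>t. t \<in> \<Gamma> k \<Longrightarrow> norm (poly (monom 1 i) t) \<le> C" using poly_bounded_on_\<Gamma> by blast
  have "norm (\<Psi> k t * t ^ i) \<le> max 0 (B * C)" if "t \<in> \<Gamma> k" for t
  proof -
    have "norm (\<Psi> k t * t ^ i) \<le> B * C"
      unfolding norm_mult using B[OF that] C[OF that]
      by (intro mult_mono) (auto simp: poly_monom intro: order_trans[OF norm_ge_zero])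
    then show ?thesis by simp
  qed
  then show ?thesis by (intro exI[of _ "max 0 (B * C)"]) auto
qed

lemma integrable_\<Psi>_power:
  assumes "k < p" "z \<notin> complex_of_real ` {a k..b k}"
  shows "integrable (\<sigma> k) (\<lambda>t. \<Psi> k t * t ^ i / (z - t ^ N))"
proof -
  obtain \<delta> where \<delta>: "\<delta> > 0" "\<And>t. t \<in> \<Gamma> k \<Longrightarrow> \<delta> \<le> norm (z - t ^ N)"
    using power_N_separated[OF assms(2)] by blast
  obtain B where B: "B \<ge> 0" "\<And>t. t \<in> \<Gamma> k \<Longrightarrow> norm (\<Psi> k t * t ^ i) \<le> B"
    using \<Psi>_power_bounded[OF assms(1)] by blast
  have [measurable]: "\<Psi> k \<in> borel_measurable borel" using measurable_\<Psi> assms by simp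
  show ?thesis
  proof (rule integrable_bounded_on_\<Gamma>[OF assms(1), where B = "B / \<delta>"])
    fix t assume t: "t \<in> \<Gamma> k"
    show "norm (\<Psi> k t * t ^ i / (z - t ^ N)) \<le> B / \<delta>"
      unfolding norm_divide using B \<delta> t by (intro frac_le) auto
  qed measurable
qed

text \<open>The kernel \<open>1 / (z - t)\<close> is expanded as the sum of
  \<open>z ^ q * t ^ (p - q) / (z ^ N - t ^ N)\<close> over \<open>q \<le> p\<close>. Under rotation
  of \<open>t\<close> the term for \<open>q\<close> is multiplied by
  \<open>\<omega> ^ (p - q + l) / \<omega> ^ k\<close>, so rotation invariance of the measure kills
  every term but one.\<close>

lemma \<Psi>_Suc_eq:
  assumes k: "k < p" and z: "z \<notin> \<Gamma> k" and q0: "q0 \<le> p" "(p - q0 + l) mod N = k"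
  shows "\<Psi> (Suc k) z = z ^ q0 * (LINT t|\<sigma> k. \<Psi> k t * t ^ (p - q0) / (z ^ N - t ^ N))"
proof -
  have zN: "z ^ N \<notin> complex_of_real ` {a k..b k}" using z by (simp add: \<Gamma>_iff)
  have [measurable]: "\<Psi> k \<in> borel_measurable borel" using measurable_\<Psi> k by simp
  note [measurable_cong] = sets_\<sigma>[OF k]
  define I where "I = (\<lambda>i. LINT t|\<sigma> k. \<Psi> k t * t ^ i / (z ^ N - t ^ N))"
  have int: "integrable (\<sigma> k) (\<lambda>t. \<Psi> k t * t ^ i / (z ^ N - t ^ N))" for i
    by (rule integrable_\<Psi>_power[OF k zN])
  have "\<Psi> (Suc k) z = (LINT t|\<sigma> k. (\<Sum>q<Suc p. z ^ q * (\<Psi> k t * t ^ (p - q) / (z ^ N - t ^ N))))"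
    unfolding \<Psi>_Suc
  proof (rule integral_cong_AE)
    show "AE t in \<sigma> k. \<Psi> k t / (z - t) = (\<Sum>q<Suc p. z ^ q * (\<Psi> k t * t ^ (p - q) / (z ^ N - t ^ N)))"
      using AE_\<Gamma>[OF k]
    proof eventually_elim
      case (elim t)
      have "z ^ N - t ^ N \<noteq> 0" using elim zN by (auto simp: \<Gamma>_iff)
      moreover have eq: "z ^ N - t ^ N = (z - t) * (\<Sum>q<Suc p. z ^ q * t ^ (p - q))"
        unfolding N_def Suc_eq_plus1[symmetric] by (rule diff_power_eq_sum)
      ultimately have "\<Psi> k t / (z - t) = \<Psi> k t * (\<Sum>q<Suc p. z ^ q * t ^ (p - q)) / (z ^ N - t ^ N)"
        by (simp del: sum.lessThan_Suc)
      also have "\<dots> = (\<Sum>q<Suc p. z ^ q * (\<Psi> k t * t ^ (p - q) / (z ^ N - t ^ N)))"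
        by (simp add: sum_distrib_left sum_divide_distrib mult_ac del: sum.lessThan_Suc)
      finally show ?case .
    qed
  qed measurable
  also have "\<dots> = (\<Sum>q<Suc p. LINT t|\<sigma> k. z ^ q * (\<Psi> k t * t ^ (p - q) / (z ^ N - t ^ N)))"
    by (rule Bochner_Integration.integral_sum) (intro integrable_mult_right int)
  also have "\<dots> = (\<Sum>q<Suc p. z ^ q * I (p - q))"
    unfolding I_def by (rule sum.cong[OF refl], rule integral_mult_right_zero)
  also have "\<dots> = (\<Sum>q\<in>{q0}. z ^ q * I (p - q))"
  proof (rule sum.mono_neutral_right)
    show "\<forall>q\<in>{..<Suc p} - {q0}. z ^ q * I (p - q) = 0"
    proof
      fix q assume q: "q \<in> {..<Suc p} - {q0}"
      \<comment> \<open>The exponents \<open>p - q\<close> all lie below \<open>N\<close>, so a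
        congruence between two of them is an equality.\<close>
      have "(p - q + l) mod N \<noteq> k mod N"
      proof
        assume "(p - q + l) mod N = k mod N"
        then have "(p - q + l) mod N = (p - q0 + l) mod N" using q0 k by (simp add: N_def)
        then have "[p - q + l = p - q0 + l] (mod N)" by (simp add: cong_def)
        then have "[p - q = p - q0] (mod N)" by (simp only: cong_add_rcancel_nat)
        then have "p - q = p - q0" by (simp add: cong_def N_def)
        then show False using q q0 by auto
      qed
      then have ne: "\<omega> ^ (p - q + l) \<noteq> \<omega> ^ k" unfolding \<omega>_power_eq_iff .
      have "I (p - q) = 0"
        unfolding I_def
      proof (rule integral_equivariant_eq_0[OF k, where c = "\<omega> ^ (p - q + l) / \<omega> ^ k"])
        fix t
        have "\<Psi> k (\<omega> * t) = \<omega> ^ l * \<Psi> k t / \<omega> ^ k"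
          using \<Psi>_rotate[of k t] k by (simp add: field_simps)
        then show "\<Psi> k (\<omega> * t) * (\<omega> * t) ^ (p - q) / (z ^ N - (\<omega> * t) ^ N) =
            \<omega> ^ (p - q + l) / \<omega> ^ k * (\<Psi> k t * t ^ (p - q) / (z ^ N - t ^ N))"
          unfolding power_N_rotate by (simp add: power_mult_distrib power_add mult_ac)
        show "\<omega> ^ (p - q + l) / \<omega> ^ k \<noteq> 1" using ne by simp
      qed measurable
      then show "z ^ q * I (p - q) = 0" by simp
    qed
  qed (use q0 in auto)
  finally show ?thesis by (simp add: I_def)
qed

text \<open>
  This is \<open>\<Psi> k z = z powi (l - k) * \<psi> k (z ^ N)\<close> without negative exponents: by truncated
  subtraction at least one of the two powers below is 1. In this form it also holds at 0.
\<close>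

lemma \<Psi>_\<psi>_Suc:
  assumes k: "Suc k \<le> p" and z: "z \<notin> \<Gamma> k"
  shows "\<Psi> (Suc k) z * z ^ (Suc k - l) = z ^ (l - Suc k) * \<psi> (Suc k) (z ^ N)"
proof (cases "l \<le> k")
  case True
  define q0 where "q0 = p - (k - l)"
  have q: "q0 \<le> p" "p - q0 = k - l" "(p - q0 + l) mod N = k"
    using True k by (auto simp: q0_def N_def)
  \<comment> \<open>The power on the left-hand side completes \<open>z ^ q0\<close> to
    \<open>z ^ N\<close>, which is the outer factor of \<open>\<psi>\<close> in the case
    \<open>l \<le> k\<close>, taken at \<open>z ^ N\<close>.\<close>
  have "q0 + (Suc k - l) = N" using True k by (simp add: q0_def N_def)
  then have "z ^ q0 * z ^ (Suc k - l) = z ^ N" by (metis power_add)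
  then show ?thesis
    using \<Psi>_Suc_eq[OF _ z q(1,3)] \<psi>_Suc_le[OF True] k True q(2) by (simp add: mult_ac)
next
  case False
  define q0 where "q0 = l - Suc k"
  have l: "l \<le> p" using l_less by (simp add: N_def)
  have q: "q0 \<le> p" "p - q0 = N + k - l" "(p - q0 + l) mod N = k"
  proof -
    show "q0 \<le> p" "p - q0 = N + k - l" using False k l by (auto simp: q0_def N_def)
    then have "p - q0 + l = N + k" using l by (simp add: N_def)
    then have "(p - q0 + l) mod N = k mod N" by simp
    then show "(p - q0 + l) mod N = k" using k by (simp add: N_def)
  qed
  then show ?thesis
    using \<Psi>_Suc_eq[OF _ z q(1,3)] \<psi>_Suc_gt[of k] k False by (simp add: q0_def)
qed

lemma \<Psi>_\<psi>:
  assumes k: "k < p" and z: "z \<in> \<Gamma> k"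
  shows "\<Psi> k z * z ^ (k - l) = z ^ (l - k) * \<psi> k (z ^ N)"
proof (cases k)
  case 0
  then show ?thesis by (simp add: \<Psi>_0 \<psi>_0 poly_Q)
next
  case (Suc j)
  then show ?thesis using \<Psi>_\<psi>_Suc[of j z] \<Gamma>_disjoint[of j] k z by auto
qed

lemma measurable_\<psi>: "k \<le> p \<Longrightarrow> \<psi> k \<in> borel_measurable borel"
proof (cases k)
  case 0
  then show ?thesis by (simp add: \<psi>_0[abs_def])
next
  case (Suc j)
  assume kp: "k \<le> p"
  then have j: "j < p" using Suc by simp
  interpret finite_measure "\<sigma> j" by (rule finite_\<sigma>[OF j])
  note [measurable_cong] = sets_\<sigma>[OF j]
  have [measurable]: "\<Psi> j \<in> borel_measurable borel" using measurable_\<Psi> j by simp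
  show ?thesis
  proof (cases "l \<le> j")
    case True
    show ?thesis unfolding Suc \<psi>_Suc_le[OF True, abs_def] by measurable
  next
    case False
    then have "j < l" by simp
    show ?thesis unfolding Suc \<psi>_Suc_gt[OF \<open>j < l\<close>, abs_def] by measurable
  qed
qed

lemma holomorphic_\<psi>_Suc:
  assumes k: "k < p"
  shows "\<psi> (Suc k) holomorphic_on - (complex_of_real ` {a k..b k})"
proof -
  have "(\<lambda>z. LINT t|\<sigma> k. \<Psi> k t * t ^ i / (z - t ^ N)) holomorphic_on - (complex_of_real ` {a k..b k})" for i
  proof -
    obtain B where B: "\<And>t. t \<in> \<Gamma> k \<Longrightarrow> norm (\<Psi> k t * t ^ i) \<le> B"
      using \<Psi>_power_bounded[OF k] by blast
    have [measurable]: "\<Psi> k \<in> borel_measurable borel" using measurable_\<Psi> k by simp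
    note [measurable_cong] = sets_\<sigma>[OF k]
    show ?thesis
    proof (rule holomorphic_on_Cauchy_transform[OF finite_\<sigma>[OF k]])
      show "AE t in \<sigma> k. norm (\<Psi> k t * t ^ i) \<le> B" using AE_\<Gamma>[OF k] by eventually_elim (rule B)
      show "AE t in \<sigma> k. t ^ N \<in> complex_of_real ` {a k..b k}" using AE_\<Gamma>[OF k] by eventually_elim (simp add: \<Gamma>_iff)
      show "closed (complex_of_real ` {a k..b k})"
        by (intro compact_imp_closed compact_continuous_image continuous_intros) auto
    qed measurable
  qed
  note hol = this
  show ?thesis
  proof (cases "l \<le> k")
    case True
    show ?thesis unfolding \<psi>_Suc_le[OF True, abs_def] by (intro holomorphic_intros hol)
  next
    case False
    then have "k < l" by simp
    show ?thesis unfolding \<psi>_Suc_gt[OF \<open>k < l\<close>, abs_def] by (rule hol)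
  qed
qed

lemma analytic_\<psi>:
  assumes k: "k < p"
  shows "\<psi> k analytic_on complex_of_real ` {a k..b k}"
proof (cases k)
  case 0
  have "poly R holomorphic_on UNIV"
    unfolding holomorphic_on_def field_differentiable_def
    using poly_DERIV has_field_derivative_at_within by blast
  then have "poly R analytic_on UNIV" by (simp add: analytic_on_open)
  then have "poly R analytic_on complex_of_real ` {a k..b k}" by (rule analytic_on_subset) simp
  then show ?thesis using 0 by (simp add: \<psi>_0[abs_def])
next
  case (Suc j)
  have "open (- (complex_of_real ` {a j..b j}))"
    by (intro open_Compl compact_imp_closed compact_continuous_image continuous_intros) auto
  then have "\<psi> k analytic_on - (complex_of_real ` {a j..b j})"
    using holomorphic_\<psi>_Suc[of j] k Suc by (simp add: analytic_on_open)
  then show ?thesis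
    by (rule analytic_on_subset) (use intervals_disjoint[of j] k Suc in auto)
qed

text \<open>This is the recursion purely in terms of the reduced functions. For
  \<open>l \<le> k\<close> the power of \<open>t\<close> in the definition just turns
  \<open>\<Psi> k\<close> into \<open>\<psi> k\<close>; for \<open>k < l\<close> it combines with
  the factor \<open>t ^ (l - k)\<close> into a full \<open>t ^ N\<close>.\<close>

lemma \<psi>_Suc_integral:
  assumes k: "k < p"
  shows "\<psi> (Suc k) z = (if l \<le> k then z else 1) * (LINT t|\<sigma> k. \<psi> k (t ^ N) * (t ^ N) ^ \<epsilon> k / (z - t ^ N))"
proof -
  have [measurable]: "\<Psi> k \<in> borel_measurable borel" "\<psi> k \<in> borel_measurable borel"
    using measurable_\<Psi> measurable_\<psi> k by auto
  note [measurable_cong] = sets_\<sigma>[OF k]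
  define i where "i = (if l \<le> k then k - l else N + k - l)"
  have eq: "(LINT t|\<sigma> k. \<Psi> k t * t ^ i / (z - t ^ N)) =
      (LINT t|\<sigma> k. \<psi> k (t ^ N) * (t ^ N) ^ \<epsilon> k / (z - t ^ N))"
  proof (rule integral_cong_AE)
    show "AE t in \<sigma> k. \<Psi> k t * t ^ i / (z - t ^ N) = \<psi> k (t ^ N) * (t ^ N) ^ \<epsilon> k / (z - t ^ N)"
      using AE_\<Gamma>[OF k]
    proof eventually_elim
      case (elim t)
      note rel = \<Psi>_\<psi>[OF k elim]
      have "\<Psi> k t * t ^ i = \<psi> k (t ^ N) * (t ^ N) ^ \<epsilon> k"
      proof (cases "l \<le> k")
        case True
        then show ?thesis using rel by (simp add: i_def \<epsilon>_def)
      next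
        case False
        then have "N = (l - k) + i" using l_less by (simp add: i_def)
        then have "t ^ N = t ^ (l - k) * t ^ i" by (metis power_add)
        then show ?thesis using rel False by (simp add: \<epsilon>_def mult_ac)
      qed
      then show ?case by simp
    qed
  qed measurable
  show ?thesis
  proof (cases "l \<le> k")
    case True
    have "i = k - l" using True by (simp add: i_def)
    with eq show ?thesis unfolding \<psi>_Suc_le[OF True] using True by simp
  next
    case False
    then have "k < l" "i = N + k - l" by (simp_all add: i_def)
    with eq show ?thesis unfolding \<psi>_Suc_gt[OF \<open>k < l\<close>] by simp
  qed
qed

section \<open>Zeros of the functions of the second kind\<close>

text \<open>This permits Fubini in \<open>orthogonality_\<Psi>\<close>: consecutive stars have
  positive distance, so the kernel is bounded on their product.\<close>

lemma integrable_on_product: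
  assumes k: "Suc k \<le> j" "j < p"
  shows "integrable (\<sigma> k \<Otimes>\<^sub>M \<sigma> (Suc k))
    (\<lambda>(x, t). \<Psi> k x * (t ^ s * nikishin_density \<sigma> (Suc k) j t / (t - x)))"
proof -
  have kp: "k < p" "Suc k < p" using k by auto
  let ?D = "nikishin_density \<sigma> (Suc k) j"
  interpret A: finite_measure "\<sigma> k" by (rule finite_\<sigma>[OF kp(1)])
  interpret B: finite_measure "\<sigma> (Suc k)" by (rule finite_\<sigma>[OF kp(2)])
  interpret pair_sigma_finite "\<sigma> k" "\<sigma> (Suc k)" ..
  interpret P: finite_measure "\<sigma> k \<Otimes>\<^sub>M \<sigma> (Suc k)"
    by (rule finite_measure_pair_measure) unfold_locales
  note [measurable_cong] = sets_\<sigma>[OF kp(1)] sets_\<sigma>[OF kp(2)]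
  have [measurable]: "\<Psi> k \<in> borel_measurable borel" "?D \<in> borel_measurable borel"
    using measurable_\<Psi> measurable_nikishin_density k by auto
  have [measurable]: "\<Gamma> k \<in> sets borel" "\<Gamma> (Suc k) \<in> sets borel" using closed_\<Gamma> by auto
  obtain B1 where B1: "\<And>t. t \<in> \<Gamma> k \<Longrightarrow> norm (\<Psi> k t) \<le> B1" using \<Psi>_bounded kp by blast
  obtain B2 where B2: "\<And>t. t \<in> \<Gamma> (Suc k) \<Longrightarrow> norm (poly (monom 1 s) t) \<le> B2"
    using poly_bounded_on_\<Gamma> by blast
  obtain B3 where B3: "\<And>t. t \<in> \<Gamma> (Suc k) \<Longrightarrow> norm (?D t) \<le> B3"
    using nikishin_density_bounded[OF k] by blast
  obtain \<delta> where \<delta>: "\<delta> > 0" "\<And>z t. z \<in> \<Gamma> k \<Longrightarrow> t \<in> \<Gamma> (Suc k) \<Longrightarrow> \<delta> \<le> norm (z - t)"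
    using \<Gamma>_separated[OF kp(2)] by blast
  have "AE z in \<sigma> k \<Otimes>\<^sub>M \<sigma> (Suc k). fst z \<in> \<Gamma> k \<and> snd z \<in> \<Gamma> (Suc k)"
  proof (rule AE_pair_measure)
    show "AE x in \<sigma> k. AE y in \<sigma> (Suc k). fst (x, y) \<in> \<Gamma> k \<and> snd (x, y) \<in> \<Gamma> (Suc k)"
      using AE_\<Gamma>[OF kp(1)] by eventually_elim (use AE_\<Gamma>[OF kp(2)] in auto)
  qed measurable
  then have "AE z in \<sigma> k \<Otimes>\<^sub>M \<sigma> (Suc k).
    norm ((\<lambda>(x, t). \<Psi> k x * (t ^ s * ?D t / (t - x))) z) \<le> B1 * (B2 * B3 / \<delta>)"
  proof eventually_elim
    case (elim z)
    obtain x t where z: "z = (x, t)" by (cases z)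
    have x: "x \<in> \<Gamma> k" and t: "t \<in> \<Gamma> (Suc k)" using elim z by auto
    have *: "0 \<le> B1" "0 \<le> B2" "0 \<le> B3"
      using B1[OF x] B2[OF t] B3[OF t] by (auto intro: order_trans[OF norm_ge_zero])
    have "norm (\<Psi> k x * (t ^ s * ?D t / (t - x))) \<le> B1 * (B2 * B3 / \<delta>)"
      unfolding norm_mult norm_divide
      using B1[OF x] B2[OF t] B3[OF t] \<delta>(1) \<delta>(2)[OF x t] *
      by (intro mult_mono frac_le) (auto simp: poly_monom norm_minus_commute norm_mult)
    then show ?case by (simp add: z)
  qed
  then show ?thesis by (rule P.integrable_const_bound) measurable
qed

text \<open>Subtracting \<open>x ^ s\<close> from \<open>t ^ s\<close> cancels the pole and leaves a
  polynomial in \<open>x\<close> of degree below \<open>s\<close>. The subtracted part reproduces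
  the density one level down, with a minus sign because the kernel here is
  \<open>1 / (t - x)\<close>.\<close>

lemma power_Cauchy_transform:
  assumes k: "Suc k \<le> j" "j < p" and x: "x \<in> \<Gamma> k"
  shows "(LINT t|\<sigma> (Suc k). t ^ s * nikishin_density \<sigma> (Suc k) j t / (t - x)) =
    (\<Sum>q<s. (LINT t|\<sigma> (Suc k). t ^ q * nikishin_density \<sigma> (Suc k) j t) * x ^ (s - Suc q)) -
    x ^ s * nikishin_density \<sigma> k j x"
proof -
  have kp: "k < p" "Suc k < p" using k by auto
  let ?D = "nikishin_density \<sigma> (Suc k) j"
  note [measurable_cong] = sets_\<sigma>[OF kp(2)]
  have [measurable]: "?D \<in> borel_measurable borel"
    using measurable_nikishin_density k by auto
  obtain B3 where B3: "\<And>t. t \<in> \<Gamma> (Suc k) \<Longrightarrow> norm (?D t) \<le> B3"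
    using nikishin_density_bounded[OF k] by blast
  obtain \<delta> where \<delta>: "\<delta> > 0" "\<And>t. t \<in> \<Gamma> (Suc k) \<Longrightarrow> \<delta> \<le> norm (x - t)"
    using \<Gamma>_separated[OF kp(2)] x by metis
  have int1: "integrable (\<sigma> (Suc k)) (\<lambda>t. t ^ q * ?D t)" for q
  proof -
    obtain B2 where B2: "\<And>t. t \<in> \<Gamma> (Suc k) \<Longrightarrow> norm (poly (monom 1 q) t) \<le> B2"
      using poly_bounded_on_\<Gamma> by blast
    show ?thesis
    proof (rule integrable_bounded_on_\<Gamma>[OF kp(2), where B = "B2 * B3"])
      fix t assume t: "t \<in> \<Gamma> (Suc k)"
      show "norm (t ^ q * ?D t) \<le> B2 * B3"
        unfolding norm_mult using B2[OF t] B3[OF t]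
        by (intro mult_mono) (auto simp: poly_monom intro: order_trans[OF norm_ge_zero])
    qed measurable
  qed
  have int2: "integrable (\<sigma> (Suc k)) (\<lambda>t. ?D t / (x - t))"
  proof (rule integrable_bounded_on_\<Gamma>[OF kp(2), where B = "B3 / \<delta>"])
    fix t assume t: "t \<in> \<Gamma> (Suc k)"
    show "norm (?D t / (x - t)) \<le> B3 / \<delta>"
      unfolding norm_divide using B3[OF t] \<delta>(1) \<delta>(2)[OF t]
      by (intro frac_le) (auto intro: order_trans[OF norm_ge_zero])
  qed measurable
  have "(LINT t|\<sigma> (Suc k). t ^ s * ?D t / (t - x)) =
     (LINT t|\<sigma> (Suc k). (\<Sum>q<s. t ^ q * ?D t * x ^ (s - Suc q)) - x ^ s * (?D t / (x - t)))"
  proof (rule integral_cong_AE)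
    show "AE t in \<sigma> (Suc k). t ^ s * ?D t / (t - x) =
      (\<Sum>q<s. t ^ q * ?D t * x ^ (s - Suc q)) - x ^ s * (?D t / (x - t))"
      using AE_\<Gamma>[OF kp(2)]
    proof eventually_elim
      case (elim t)
      have tx: "t - x \<noteq> 0" using \<delta>(1) \<delta>(2)[OF elim] by auto
      have "t ^ s - x ^ s = (t - x) * (\<Sum>q<s. x ^ (s - Suc q) * t ^ q)"
        by (rule power_diff_sumr2)
      then have ts: "t ^ s = (t - x) * (\<Sum>q<s. x ^ (s - Suc q) * t ^ q) + x ^ s"
        by (simp add: algebra_simps)
      have "t ^ s * ?D t / (t - x) = (\<Sum>q<s. x ^ (s - Suc q) * t ^ q) * ?D t + x ^ s * ?D t / (t - x)"
        unfolding ts using tx by (simp add: divide_simps) (simp add: algebra_simps)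
      also have "x ^ s * ?D t / (t - x) = - (x ^ s * (?D t / (x - t)))"
        by (metis minus_diff_eq minus_divide_right times_divide_eq_right)
      finally show ?case by (simp add: sum_distrib_left mult_ac)
    qed
  qed measurable
  also have "\<dots> = (\<Sum>q<s. LINT t|\<sigma> (Suc k). t ^ q * ?D t * x ^ (s - Suc q)) -
     (LINT t|\<sigma> (Suc k). x ^ s * (?D t / (x - t)))"
    using int1 int2 by (subst Bochner_Integration.integral_diff)
      (auto simp del: times_divide_eq_right intro!: Bochner_Integration.integral_sum Bochner_Integration.integrable_sum)
  also have "(\<Sum>q<s. LINT t|\<sigma> (Suc k). t ^ q * ?D t * x ^ (s - Suc q)) =
      (\<Sum>q<s. (LINT t|\<sigma> (Suc k). t ^ q * ?D t) * x ^ (s - Suc q))"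
    by (rule sum.cong[OF refl], rule integral_mult_left_zero)
  also have "(LINT t|\<sigma> (Suc k). x ^ s * (?D t / (x - t))) = x ^ s * (LINT t|\<sigma> (Suc k). ?D t / (x - t))"
    by (rule integral_mult_right_zero)
  also have "(LINT t|\<sigma> (Suc k). ?D t / (x - t)) = nikishin_density \<sigma> k j x"
    using k by (subst (2) nikishin_density.simps) simp
  finally show ?thesis .
qed

text \<open>After exchanging the integrals, the inner one is given by
  \<open>power_Cauchy_transform\<close>. Its polynomial part is killed by the hypothesis for the
  constant density (\<open>j = k\<close>), as its exponents \<open>i < s\<close> satisfy
  \<open>p * i + k < n\<close>; its last term is killed by the hypothesis for the same
  \<open>j\<close> and \<open>s\<close>.\<close>

lemma orthogonality_\<Psi>:
  "k \<le> j \<Longrightarrow> j < p \<Longrightarrow> p * s + j < n \<Longrightarrow>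
    (LINT t|\<sigma> k. \<Psi> k t * (t ^ s * nikishin_density \<sigma> k j t)) = 0"
proof (induction k arbitrary: j s)
  case 0
  have "multi_orthogonal p \<sigma> n Q" using is_mop_mop by (simp add: Q_def)
  then show ?case
    using 0 unfolding multi_orthogonal_def le_floor_iff_nat nikishin_integral_def
    by (simp add: \<Psi>_0 mult.assoc)
next
  case (Suc k)
  have kp: "k < p" "Suc k < p" using Suc.prems by auto
  let ?D = "nikishin_density \<sigma> (Suc k) j"
  define c where "c = (\<lambda>q. LINT t|\<sigma> (Suc k). t ^ q * ?D t)"
  interpret A: finite_measure "\<sigma> k" by (rule finite_\<sigma>[OF kp(1)])
  interpret B: finite_measure "\<sigma> (Suc k)" by (rule finite_\<sigma>[OF kp(2)])
  interpret pair_sigma_finite "\<sigma> k" "\<sigma> (Suc k)" ..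
  note [measurable_cong] = sets_\<sigma>[OF kp(1)] sets_\<sigma>[OF kp(2)]
  have [measurable]: "\<Psi> k \<in> borel_measurable borel" "?D \<in> borel_measurable borel"
      "nikishin_density \<sigma> k j \<in> borel_measurable borel"
    using measurable_\<Psi> measurable_nikishin_density Suc.prems by auto
  obtain B where B: "\<And>t. t \<in> \<Gamma> k \<Longrightarrow> norm (nikishin_density \<sigma> k j t) \<le> B"
    using nikishin_density_bounded[of k j] Suc.prems by auto
  have int1: "integrable (\<sigma> k) (\<lambda>x. \<Psi> k x * x ^ i)" for i
  proof -
    obtain C where "\<And>t. t \<in> \<Gamma> k \<Longrightarrow> norm (\<Psi> k t * t ^ i) \<le> C"
      using \<Psi>_power_bounded[OF kp(1)] by blast
    then show ?thesis by (intro integrable_bounded_on_\<Gamma>[OF kp(1), where B = C]) auto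
  qed
  have int2: "integrable (\<sigma> k) (\<lambda>x. \<Psi> k x * (x ^ i * nikishin_density \<sigma> k j x))" for i
  proof -
    obtain C where C: "\<And>t. t \<in> \<Gamma> k \<Longrightarrow> norm (\<Psi> k t * t ^ i) \<le> C"
      using \<Psi>_power_bounded[OF kp(1)] by blast
    show ?thesis
    proof (rule integrable_bounded_on_\<Gamma>[OF kp(1), where B = "C * B"])
      fix t assume t: "t \<in> \<Gamma> k"
      have "norm (\<Psi> k t * t ^ i * nikishin_density \<sigma> k j t) \<le> C * B"
        unfolding norm_mult[of "\<Psi> k t * t ^ i"] using C[OF t] B[OF t]
        by (intro mult_mono) (auto intro: order_trans[OF norm_ge_zero])
      then show "norm (\<Psi> k t * (t ^ i * nikishin_density \<sigma> k j t)) \<le> C * B"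
        by (simp add: mult.assoc)
    qed measurable
  qed
  have IH1: "(LINT x|\<sigma> k. \<Psi> k x * x ^ i) = 0" if "i < s" for i
  proof -
    have "p * i + k < n"
    proof -
      have "p * i \<le> p * s" using that by simp
      then show ?thesis using Suc.prems by linarith
    qed
    from Suc.IH[OF _ _ this] kp show ?thesis by (simp add: nikishin_density.simps)
  qed
  have IH2: "(LINT x|\<sigma> k. \<Psi> k x * (x ^ s * nikishin_density \<sigma> k j x)) = 0"
    using Suc.prems by (intro Suc.IH) auto
  have "(LINT t|\<sigma> (Suc k). \<Psi> (Suc k) t * (t ^ s * ?D t)) =
      (LINT t|\<sigma> (Suc k). (LINT x|\<sigma> k. \<Psi> k x * (t ^ s * ?D t / (t - x))))"
  proof (rule Bochner_Integration.integral_cong[OF refl])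
    fix t
    have "\<Psi> (Suc k) t * (t ^ s * ?D t) = (LINT x|\<sigma> k. \<Psi> k x / (t - x) * (t ^ s * ?D t))"
      unfolding \<Psi>_Suc by (rule integral_mult_left_zero[symmetric])
    then show "\<Psi> (Suc k) t * (t ^ s * ?D t) = (LINT x|\<sigma> k. \<Psi> k x * (t ^ s * ?D t / (t - x)))"
      by simp
  qed
  also have "\<dots> = (LINT x|\<sigma> k. (LINT t|\<sigma> (Suc k). \<Psi> k x * (t ^ s * ?D t / (t - x))))"
    by (rule Fubini_integral) (rule integrable_on_product[OF Suc.prems(1,2)])
  also have "\<dots> = (LINT x|\<sigma> k. (\<Sum>q<s. c q * (\<Psi> k x * x ^ (s - Suc q))) -
      \<Psi> k x * (x ^ s * nikishin_density \<sigma> k j x))"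
  proof (rule integral_cong_AE)
    show "AE x in \<sigma> k. (LINT t|\<sigma> (Suc k). \<Psi> k x * (t ^ s * ?D t / (t - x))) =
      (\<Sum>q<s. c q * (\<Psi> k x * x ^ (s - Suc q))) - \<Psi> k x * (x ^ s * nikishin_density \<sigma> k j x)"
      using AE_\<Gamma>[OF kp(1)]
    proof eventually_elim
      case (elim x)
      have "(LINT t|\<sigma> (Suc k). \<Psi> k x * (t ^ s * ?D t / (t - x))) =
          \<Psi> k x * (LINT t|\<sigma> (Suc k). t ^ s * ?D t / (t - x))"
        by (rule integral_mult_right_zero)
      then show ?case
        unfolding power_Cauchy_transform[OF Suc.prems(1,2) elim] c_def
        by (simp add: right_diff_distrib sum_distrib_left mult_ac)
    qed
  qed measurable
  also have "\<dots> = (LINT x|\<sigma> k. (\<Sum>q<s. c q * (\<Psi> k x * x ^ (s - Suc q)))) -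
      (LINT x|\<sigma> k. \<Psi> k x * (x ^ s * nikishin_density \<sigma> k j x))"
    by (rule Bochner_Integration.integral_diff)
      (intro Bochner_Integration.integrable_sum integrable_mult_right int1 int2)+
  also have "(LINT x|\<sigma> k. (\<Sum>q<s. c q * (\<Psi> k x * x ^ (s - Suc q)))) =
      (\<Sum>q<s. LINT x|\<sigma> k. c q * (\<Psi> k x * x ^ (s - Suc q)))"
    by (rule Bochner_Integration.integral_sum) (intro integrable_mult_right int1)
  also have "\<dots> = (\<Sum>q<s. c q * (LINT x|\<sigma> k. \<Psi> k x * x ^ (s - Suc q)))"
    by (rule sum.cong[OF refl], rule integral_mult_right_zero)
  also have "\<dots> = 0" using IH1 by (intro sum.neutral) auto
  finally show ?case using IH2 by simp
qed

section \<open>Push-forward to the real intervals, real values and moments\<close>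

definition \<mu> :: "nat \<Rightarrow> real measure" where
  "\<mu> k = distr (\<sigma> k) borel (\<lambda>t. Re (t ^ N))"

lemma measurable_Re_power [measurable]: "(\<lambda>t. Re (t ^ N)) \<in> borel_measurable borel"
  by measurable

lemma sets_\<mu>: "sets (\<mu> k) = sets borel" by (simp add: \<mu>_def)

lemma finite_\<mu>: "k < p \<Longrightarrow> finite_measure (\<mu> k)"
  unfolding \<mu>_def using finite_\<sigma> by (intro finite_measure.finite_measure_distr) (auto simp: meas_\<sigma>)

lemma AE_\<mu>_iff:
  assumes "k < p" "{s. P s} \<in> sets borel"
  shows "(AE s in \<mu> k. P s) \<longleftrightarrow> (AE t in \<sigma> k. P (Re (t ^ N)))"
  unfolding \<mu>_def using assms by (intro AE_distr_iff) (auto simp: meas_\<sigma>)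

lemma AE_\<mu>: assumes "k < p" shows "AE s in \<mu> k. s \<in> {a k..b k}"
proof -
  have "AE t in \<sigma> k. Re (t ^ N) \<in> {a k..b k}"
    using AE_\<Gamma>[OF assms] by eventually_elim (metis \<Gamma>_iff Re_complex_of_real imageE)
  then show ?thesis using assms by (subst AE_\<mu>_iff) auto
qed

text \<open>A finite set has finitely many \<open>N\<close>-th roots. Their complement would be an
  open null set, which confines the support of \<open>\<sigma> k\<close> to finitely many
  points.\<close>

lemma \<mu>_infinite:
  assumes k: "k < p" and F: "finite F"
  shows "\<not> (AE s in \<mu> k. s \<in> F)"
proof
  assume "AE s in \<mu> k. s \<in> F"
  then have "AE t in \<sigma> k. Re (t ^ N) \<in> F" using F k by (subst (asm) AE_\<mu>_iff) (auto intro: borel_closed finite_imp_closed)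
  define G where "G = (\<Union>x\<in>F. {t. t ^ N = complex_of_real x})"
  have finG: "finite G" using F unfolding G_def by (auto intro!: finite_nth_roots)
  have "AE t in \<sigma> k. t \<in> G"
    using \<open>AE t in \<sigma> k. Re (t ^ N) \<in> F\<close> AE_\<Gamma>[OF k]
  proof eventually_elim
    case (elim t)
    then obtain x where "t ^ N = complex_of_real x" unfolding \<Gamma>_iff by blast
    then show ?case using elim by (auto simp: G_def)
  qed
  then have null: "emeasure (\<sigma> k) (- G) = 0"
    using finG k by (subst (asm) AE_iff_measurable[where N = "- G"])
      (auto simp: sets_\<sigma> sets_eq_imp_space_eq[OF sets_\<sigma>[OF k]] intro: borel_closed[THEN borel_comp] finite_imp_closed)
  have "measure_support (\<sigma> k) \<subseteq> G"
  proof
    fix z assume z: "z \<in> measure_support (\<sigma> k)"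
    show "z \<in> G"
    proof (rule ccontr)
      assume "z \<notin> G"
      moreover have "open (- G)" using finG by (simp add: finite_imp_closed open_Compl)
      ultimately have "emeasure (\<sigma> k) (- G) > 0"
        using z by (simp add: measure_support_def)
      then show False using null by simp
    qed
  qed
  then show False using infinite_support[OF k] finG finite_subset by blast
qed

lemma integral_\<mu>:
  assumes k: "k < p" and [measurable]: "h \<in> borel_measurable borel" "G \<in> borel_measurable borel"
    and eq: "\<And>t s. t \<in> \<Gamma> k \<Longrightarrow> t ^ N = complex_of_real s \<Longrightarrow> G t = complex_of_real (h s)"
  shows "(LINT t|\<sigma> k. G t) = complex_of_real (LINT s|\<mu> k. h s)"
proof -
  note [measurable_cong] = sets_\<sigma>[OF k]
  have "(LINT t|\<sigma> k. G t) = (LINT t|\<sigma> k. complex_of_real (h (Re (t ^ N))))"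
  proof (rule integral_cong_AE)
    show "AE t in \<sigma> k. G t = complex_of_real (h (Re (t ^ N)))"
      using AE_\<Gamma>[OF k]
    proof eventually_elim
      case (elim t)
      then obtain x where "t ^ N = complex_of_real x" unfolding \<Gamma>_iff by blast
      then show ?case using eq[OF elim] by simp
    qed
  qed measurable
  also have "\<dots> = complex_of_real (LINT t|\<sigma> k. h (Re (t ^ N)))" by (rule integral_complex_of_real)
  also have "(LINT t|\<sigma> k. h (Re (t ^ N))) = (LINT s|\<mu> k. h s)"
    unfolding \<mu>_def by (rule integral_distr[symmetric]) measurable
  finally show ?thesis .
qed

text \<open>Real values at level \<open>k\<close> are a hypothesis because
  \<open>\<psi>_real\<close> is itself obtained from this lemma by induction.\<close>

lemma \<psi>_real_and_integral:
  assumes k: "k < p" and real: "\<And>s. \<psi> k (complex_of_real s) \<in> \<real>"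
  shows "\<psi> (Suc k) (complex_of_real x) = complex_of_real ((if l \<le> k then x else 1) *
    (LINT s|\<mu> k. Re (\<psi> k (complex_of_real s)) * s ^ \<epsilon> k / (x - s)))"
proof -
  have [measurable]: "\<psi> k \<in> borel_measurable borel" using measurable_\<psi> k by simp
  have "(LINT t|\<sigma> k. \<psi> k (t ^ N) * (t ^ N) ^ \<epsilon> k / (complex_of_real x - t ^ N)) =
    complex_of_real (LINT s|\<mu> k. Re (\<psi> k (complex_of_real s)) * s ^ \<epsilon> k / (x - s))"
  proof (rule integral_\<mu>[OF k])
    fix t s assume "t ^ N = complex_of_real s"
    moreover have "\<psi> k (complex_of_real s) = complex_of_real (Re (\<psi> k (complex_of_real s)))"
      using real[of s] by simp
    ultimately show "\<psi> k (t ^ N) * (t ^ N) ^ \<epsilon> k / (complex_of_real x - t ^ N) =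
      complex_of_real (Re (\<psi> k (complex_of_real s)) * s ^ \<epsilon> k / (x - s))"
      by (metis of_real_diff of_real_divide of_real_mult of_real_power)
  qed measurable
  then show ?thesis unfolding \<psi>_Suc_integral[OF k] by simp
qed

lemma \<psi>_real: "k \<le> p \<Longrightarrow> \<psi> k (complex_of_real x) \<in> \<real>"
proof (induction k arbitrary: x)
  case 0
  show ?case unfolding \<psi>_0 poly_altdef
    by (intro sum_in_Reals Reals_mult Reals_power coeff_R_real) auto
next
  case (Suc k)
  then show ?case by (subst \<psi>_real_and_integral) auto
qed

lemma less_M_count_iff:
  assumes k: "k < p"
  shows "r < M_count p n l k \<longleftrightarrow> p * N * (r + \<epsilon> k) + k * N < n + p * l"
proof -
  define h where "h = \<lfloor>(real n + real p * real l - 1 - real k * (real p + 1)) / (real p * (real p + 1))\<rfloor>"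
  \<comment> \<open>The quotient lies strictly between -1 and 1, so its ceiling is 0 or 1 according
    to whether \<open>k < l\<close>.\<close>
  have c: "\<lceil>(real l - real k) / (real p + 1)\<rceil> = int (\<epsilon> k)"
  proof (cases "k < l")
    case True
    then show ?thesis using l_less unfolding \<epsilon>_def
      by (intro ceiling_unique) (auto simp: field_simps N_def)
  next
    case False
    then show ?thesis using k unfolding \<epsilon>_def
      by (intro ceiling_unique) (auto simp: field_simps)
  qed
  have "M_count p n l k = card {int (\<epsilon> k)..h}"
    unfolding M_count_def c h_def by (rule arg_cong[where f = card]) auto
  then have "r < M_count p n l k \<longleftrightarrow> int (r + \<epsilon> k) \<le> h" by auto
  also have "\<dots> \<longleftrightarrow> real (r + \<epsilon> k) * (real p * (real p + 1)) \<le> real n + real p * real l - 1 - real k * (real p + 1)"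
    unfolding h_def using p_pos by (simp add: le_floor_iff pos_le_divide_eq)
  also have "\<dots> \<longleftrightarrow> real (p * N * (r + \<epsilon> k) + k * N + 1) \<le> real (n + p * l)"
    by (simp add: N_def algebra_simps)
  also have "\<dots> \<longleftrightarrow> p * N * (r + \<epsilon> k) + k * N < n + p * l" unfolding of_nat_le_iff by linarith
  finally show ?thesis .
qed

text \<open>The exponent \<open>s\<close> is fixed by
  \<open>s + l = N * (r + \<epsilon> k) + k\<close>, which makes \<open>\<Psi> k t * t ^ s\<close> a
  function of \<open>t ^ N\<close>. The available orthogonality \<open>p * s + k < n\<close> is then
  exactly the condition counted by \<open>M_count\<close>.\<close>

lemma \<psi>_moments:
  assumes k: "k < p" and r: "r < M_count p n l k"
  shows "(LINT s|\<mu> k. Re (\<psi> k (complex_of_real s)) * s ^ \<epsilon> k * s ^ r) = 0"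
proof -
  have [measurable]: "\<psi> k \<in> borel_measurable borel" "\<Psi> k \<in> borel_measurable borel"
    using measurable_\<psi> measurable_\<Psi> k by auto
  \<comment> \<open>No truncation occurs in this subtraction: for \<open>k < l\<close> the term
    \<open>\<epsilon> k\<close> contributes a full \<open>N\<close>, which exceeds
    \<open>l\<close>.\<close>
  define s where "s = N * (r + \<epsilon> k) + k - l"
  have s: "s + l = N * (r + \<epsilon> k) + k"
    using l_less by (auto simp: s_def \<epsilon>_def)
  have "p * s + p * l = p * N * (r + \<epsilon> k) + p * k"
    using arg_cong[OF s, of "(*) p"] by (simp add: algebra_simps)
  moreover have "k * N = p * k + k" by (simp add: N_def)
  ultimately have "p * s + k < n" using r less_M_count_iff[OF k, of r] by linarith
  then have "(LINT t|\<sigma> k. \<Psi> k t * t ^ s) = 0"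
    using orthogonality_\<Psi>[of k k s] k by (simp add: nikishin_density.simps)
  moreover have "(LINT t|\<sigma> k. \<Psi> k t * t ^ s) =
    complex_of_real (LINT s|\<mu> k. Re (\<psi> k (complex_of_real s)) * s ^ \<epsilon> k * s ^ r)"
  proof (rule integral_\<mu>[OF k])
    fix t x assume t: "t \<in> \<Gamma> k" "t ^ N = complex_of_real x"
    have "\<Psi> k t * t ^ s = \<psi> k (t ^ N) * (t ^ N) ^ (\<epsilon> k + r)"
    proof (cases "l \<le> k")
      case True
      then have "s = (k - l) + N * (\<epsilon> k + r)" using s by (simp add: add.commute)
      then have "t ^ s = t ^ (k - l) * (t ^ N) ^ (\<epsilon> k + r)" by (simp only: power_add power_mult)
      then show ?thesis using \<Psi>_\<psi>[OF k t(1)] True by (simp add: mult.assoc[symmetric])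
    next
      case False
      then have "(l - k) + s = N * (\<epsilon> k + r)" using s by (simp add: add.commute)
      then have "t ^ (l - k) * t ^ s = (t ^ N) ^ (\<epsilon> k + r)" by (metis power_add power_mult)
      then show ?thesis using \<Psi>_\<psi>[OF k t(1)] False by (simp add: mult_ac)
    qed
    moreover have "\<psi> k (complex_of_real x) = complex_of_real (Re (\<psi> k (complex_of_real x)))"
      using \<psi>_real[of k x] k by simp
    ultimately show "\<Psi> k t * t ^ s = complex_of_real (Re (\<psi> k (complex_of_real x)) * x ^ \<epsilon> k * x ^ r)"
      unfolding t(2) by (metis mult.assoc of_real_mult of_real_power power_add)
  qed measurable
  ultimately show ?thesis by simp
qed

section \<open>Passing zeros from one level to the next\<close>

definition odd_zeros :: "nat \<Rightarrow> real set" where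
  "odd_zeros k = {x\<in>{a k<..<b k}. odd_zero (\<psi> k) (complex_of_real x)}"

text \<open>\<open>X\<close> may be any finite set of zeros, of whatever multiplicity: arbitrary
  zeros serve to prove finiteness, the odd ones serve in the count, and the empty set serves at the
  last level \<open>k = p - 1\<close>.\<close>

lemma card_odd_zeros_ge:
  assumes k: "k < p" and fin: "finite {s\<in>{a k..b k}. \<psi> k (complex_of_real s) = 0}"
    and X: "finite X" "X \<noteq> {} \<Longrightarrow> Suc k < p \<and> X \<subseteq> {a (Suc k)<..<b (Suc k)}"
      "\<And>x. x \<in> X \<Longrightarrow> \<psi> (Suc k) (complex_of_real x) = 0"
  shows "M_count p n l k + card X \<le> card (odd_zeros k)"
  unfolding odd_zeros_def
proof (rule odd_zeros_lower_bound[where \<mu> = "\<mu> k" and e = "\<epsilon> k"])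
  show "X \<inter> {a k..b k} = {}"
  proof (cases "X = {}")
    case False
    then show ?thesis using X(2) intervals_disjoint[of k] by fastforce
  qed simp
  show "(LINT s|\<mu> k. Re (\<psi> k (complex_of_real s)) * s ^ \<epsilon> k / (x - s)) = 0" if x: "x \<in> X" for x
  proof -
    \<comment> \<open>For \<open>l \<le> k\<close> the function carries an outer factor
      \<open>x\<close>, which has to be cancelled; an open interval on one side of 0 does not
      contain 0.\<close>
    have "x \<noteq> 0" using x X(2) opposite_signs[of k] ab[of "Suc k"] by fastforce
    moreover have "\<psi> (Suc k) (complex_of_real x) = complex_of_real ((if l \<le> k then x else 1) *
      (LINT s|\<mu> k. Re (\<psi> k (complex_of_real s)) * s ^ \<epsilon> k / (x - s)))"
      using k by (intro \<psi>_real_and_integral \<psi>_real) auto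
    ultimately show ?thesis using X(3)[OF x] by (auto split: if_splits)
  qed
  show "\<not> (AE s in \<mu> k. s \<in> A)" if "finite A" for A using \<mu>_infinite[OF k that] .
  show "\<psi> k \<in> borel_measurable borel" using k by (intro measurable_\<psi>) simp
  show "\<psi> k (complex_of_real s) \<in> \<real>" for s using k by (intro \<psi>_real) simp
qed (fact finite_\<mu>[OF k] sets_\<mu> AE_\<mu>[OF k] ab[OF k] analytic_\<psi>[OF k] fin X(1) \<psi>_moments[OF k])+

text \<open>From an infinite zero set one more zero than the number of odd zeros at the previous
  level can be selected, contradicting \<open>card_odd_zeros_ge\<close> there. Only the two
  endpoints fall outside the open interval.\<close>

lemma finite_zeros_\<psi>: "k < p \<Longrightarrow> finite {s\<in>{a k..b k}. \<psi> k (complex_of_real s) = 0}"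
proof (induction k)
  case 0
  have "finite {z. poly R z = 0}" using R_nz by (rule poly_roots_finite)
  then have "finite (complex_of_real -` {z. poly R z = 0})"
    by (rule finite_vimageI) (simp add: inj_of_real)
  then show ?case by (rule rev_finite_subset) (auto simp: \<psi>_0)
next
  case (Suc k)
  show ?case
  proof (rule ccontr)
    assume inf: "infinite {s\<in>{a (Suc k)..b (Suc k)}. \<psi> (Suc k) (complex_of_real s) = 0}"
    have "{s\<in>{a (Suc k)..b (Suc k)}. \<psi> (Suc k) (complex_of_real s) = 0} \<subseteq>
       insert (a (Suc k)) (insert (b (Suc k)) {s\<in>{a (Suc k)<..<b (Suc k)}. \<psi> (Suc k) (complex_of_real s) = 0})"
      by auto
    then have "infinite {s\<in>{a (Suc k)<..<b (Suc k)}. \<psi> (Suc k) (complex_of_real s) = 0}"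
      using inf finite_subset by blast
    then obtain X where X: "X \<subseteq> {s\<in>{a (Suc k)<..<b (Suc k)}. \<psi> (Suc k) (complex_of_real s) = 0}"
      "finite X" "card X = Suc (card (odd_zeros k))"
      using infinite_arbitrarily_large by blast
    have "M_count p n l k + card X \<le> card (odd_zeros k)"
      using Suc X by (intro card_odd_zeros_ge) auto
    then show False using X(3) by simp
  qed
qed

lemma finite_odd_zeros: "k < p \<Longrightarrow> finite (odd_zeros k)"
  by (rule finite_subset[OF _ finite_zeros_\<psi>[of k]]) (auto simp: odd_zeros_def odd_zero_def)

lemma Z_count_le_card_odd_zeros: "k < p \<Longrightarrow> Z_count p n l k \<le> card (odd_zeros k)"
proof (induction "p - k" arbitrary: k)
  case (Suc m)
  have Z: "Z_count p n l k = M_count p n l k + Z_count p n l (Suc k)"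
    using Suc.prems by (simp add: Z_count_def sum.atLeast_Suc_lessThan)
  show ?case
  proof (cases "Suc k < p")
    case True
    have "M_count p n l k + card (odd_zeros (Suc k)) \<le> card (odd_zeros k)"
      using Suc.prems True
      by (intro card_odd_zeros_ge finite_zeros_\<psi> finite_odd_zeros) (auto simp: odd_zeros_def odd_zero_def)
    moreover have "Z_count p n l (Suc k) \<le> card (odd_zeros (Suc k))"
      using Suc True by (intro Suc.hyps(1)) auto
    ultimately show ?thesis using Z by simp
  next
    case False
    have "M_count p n l k + card ({} :: real set) \<le> card (odd_zeros k)"
      using Suc.prems by (intro card_odd_zeros_ge finite_zeros_\<psi>) auto
    then show ?thesis using Z False by (simp add: Z_count_def)
  qed
qed simp

text \<open>
  With \<open>m = l + N * i = p * s + j\<close>, \<open>j < p\<close>, the number \<open>i\<close> is sent to the integer \<open>s - i\<close> counted by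
  \<open>M_count p n l j\<close>; it can be recovered from \<open>l + i = p * (s - i) + j\<close>.
\<close>

lemma le_Z_count:
  assumes D: "\<And>i. i < D \<Longrightarrow> l + N * i < n"
  shows "D \<le> Z_count p n l 0"
proof -
  define j s where "j = (\<lambda>i. (l + N * i) mod p)" and "s = (\<lambda>i. (l + N * i) div p)"
  have js: "p * s i + j i = l + p * i + i" for i
  proof -
    have "p * s i + j i = l + N * i" unfolding j_def s_def by (rule mult_div_mod_eq)
    then show ?thesis by (simp add: N_def)
  qed
  have jp: "j i < p" for i using p_pos by (simp add: j_def)
  \<comment> \<open>A smaller \<open>s i\<close> would make the remainder \<open>j i\<close> at
    least \<open>p\<close>. In the boundary case \<open>s i = i\<close> the remainder is
    \<open>l + i\<close>, so it is not below \<open>l\<close> and \<open>\<epsilon>\<close> is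
    0.\<close>
  have ge: "s i \<ge> i + \<epsilon> (j i)" for i
  proof (cases "s i \<le> i")
    case True
    have "s i = i"
    proof (rule ccontr)
      assume "s i \<noteq> i"
      then have "Suc (s i) \<le> i" using True by simp
      then have "p * Suc (s i) \<le> p * i" by (rule mult_le_mono2)
      then show False using js[of i] jp[of i] by simp
    qed
    then show ?thesis using js[of i] by (simp add: \<epsilon>_def)
  next
    case False
    then show ?thesis by (simp add: \<epsilon>_def)
  qed
  \<comment> \<open>The values counted by \<open>M_count\<close> start at \<open>\<epsilon>\<close>;
    subtracting it numbers them from 0, as \<open>less_M_count_iff\<close> expects.\<close>
  define F where "F = (\<lambda>i. (j i, s i - i - \<epsilon> (j i)))"
  have "inj_on F {..<D}"
  proof (rule inj_onI)
    fix i i' assume "F i = F i'"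
    then have *: "j i = j i'" "s i - i - \<epsilon> (j i) = s i' - i' - \<epsilon> (j i')" by (auto simp: F_def)
    then have "s i - i = s i' - i'" using ge[of i] ge[of i'] by simp
    moreover have "p * (s i - i) + j i = l + i" for i
      using js[of i] ge[of i] by (simp add: diff_mult_distrib2)
    ultimately show "i = i'" using * by (metis add_left_cancel)
  qed
  moreover have "F ` {..<D} \<subseteq> (SIGMA j:{0..<p}. {..<M_count p n l j})"
  proof (rule image_subsetI)
    fix i assume "i \<in> {..<D}"
    then have i: "l + N * i < n" using D by simp
    have "s i - i - \<epsilon> (j i) < M_count p n l (j i)"
      unfolding less_M_count_iff[OF jp]
    proof -
      have "p * N * (s i - i - \<epsilon> (j i) + \<epsilon> (j i)) + j i * N = N * (p * (s i - i) + j i)"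
        using ge[of i] by (simp add: algebra_simps)
      also have "p * (s i - i) + j i = l + i"
        using js[of i] ge[of i] by (simp add: diff_mult_distrib2)
      also have "N * (l + i) = p * l + (l + N * i)" by (simp add: N_def algebra_simps)
      finally show "p * N * (s i - i - \<epsilon> (j i) + \<epsilon> (j i)) + j i * N < n + p * l" using i by simp
    qed
    then show "F i \<in> (SIGMA j:{0..<p}. {..<M_count p n l j})" using jp by (simp add: F_def)
  qed
  ultimately have "card {..<D} \<le> card (SIGMA j:{0..<p}. {..<M_count p n l j})"
    by (intro card_inj_on_le) auto
  then show ?thesis by (simp add: Z_count_def)
qed

section \<open>Degree, location and simplicity of the roots at level 0\<close>

lemma odd_zeros_0_roots: "complex_of_real ` odd_zeros 0 \<subseteq> {z. poly R z = 0}"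
  by (auto simp: odd_zeros_def odd_zero_def \<psi>_0)

lemma card_odd_zeros_0: "card (complex_of_real ` odd_zeros 0) = card (odd_zeros 0)"
  by (rule card_image) (simp add: inj_on_def)

lemma Z_count_le_card_roots: "Z_count p n l 0 \<le> card {z. poly R z = 0}"
  using card_mono[OF poly_roots_finite[OF R_nz] odd_zeros_0_roots] Z_count_le_card_odd_zeros[OF p_pos]
  by (simp add: card_odd_zeros_0)

text \<open>If the degree were below \<open>n\<close>, then \<open>l + N * i < n\<close> would hold
  for every \<open>i\<close> up to \<open>degree R\<close> inclusive, and \<open>R\<close> would
  have \<open>degree R + 1\<close> roots.\<close>

lemma degree_Q_eq: "degree Q = n"
proof (rule ccontr)
  assume "degree Q \<noteq> n"
  then have "l + N * degree R < n" using degree_mop_le[of n] by (simp add: Q_def[symmetric] degree_Q)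
  moreover have "N * i \<le> N * degree R" if "i < Suc (degree R)" for i
    using that by (intro mult_le_mono2) simp
  ultimately have "Suc (degree R) \<le> Z_count p n l 0"
    by (intro le_Z_count) (meson add_left_mono le_less_trans)
  then show False using Z_count_le_card_roots card_poly_roots_bound[OF R_nz] by simp
qed

lemma card_odd_zeros_0_ge: "degree R \<le> card (odd_zeros 0)"
proof -
  have "degree R \<le> Z_count p n l 0"
  proof (rule le_Z_count)
    fix i assume "i < degree R"
    then have "N * i < N * degree R" by simp
    then show "l + N * i < n" using degree_Q degree_Q_eq by linarith
  qed
  then show ?thesis using Z_count_le_card_odd_zeros[OF p_pos] by simp
qed

text \<open>The odd zeros of \<open>\<psi> 0\<close> already provide \<open>degree R\<close>
  distinct roots, so there is no room for others.\<close>

lemma roots_R: "{z. poly R z = 0} = complex_of_real ` odd_zeros 0" "card {z. poly R z = 0} = degree R"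
proof -
  note fin = poly_roots_finite[OF R_nz]
  have le: "card {z. poly R z = 0} \<le> degree R" by (rule card_poly_roots_bound[OF R_nz])
  have ge: "degree R \<le> card (complex_of_real ` odd_zeros 0)"
    using card_odd_zeros_0_ge by (simp add: card_odd_zeros_0)
  show "{z. poly R z = 0} = complex_of_real ` odd_zeros 0"
    using card_subset_eq[OF fin odd_zeros_0_roots] card_mono[OF fin odd_zeros_0_roots] le ge by simp
  with le ge show "card {z. poly R z = 0} = degree R" by simp
qed

text \<open>A multiple root would leave a cofactor of degree \<open>degree R - 2\<close>, hence at
  most \<open>degree R - 1\<close> distinct roots in all.\<close>

lemma order_R:
  assumes "poly R z = 0"
  shows "order z R = 1"
proof (rule ccontr)
  assume "order z R \<noteq> 1"
  moreover have "order z R \<noteq> 0" using assms R_nz by (simp add: order_root)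
  ultimately have "[:-z, 1:] ^ 2 dvd R" using order_divides[of z 2 R] by simp
  then obtain S where S: "R = [:-z, 1:] ^ 2 * S" by (rule dvdE)
  have S0: "S \<noteq> 0" using R_nz S by auto
  then have "degree R = 2 + degree S" unfolding S
    by (subst degree_mult_eq) (auto simp: degree_power_eq)
  moreover have "card {w. poly R w = 0} \<le> card (insert z {w. poly S w = 0})"
    by (rule card_mono) (use poly_roots_finite[OF S0] S in auto)
  moreover have "\<dots> \<le> Suc (card {w. poly S w = 0})"
    using poly_roots_finite[OF S0] by (simp add: card_insert_if)
  ultimately show False using roots_R(2) card_poly_roots_bound[OF S0] by simp
qed

end

theorem proposition2p16:
  fixes p :: nat and a b :: "nat \<Rightarrow> real" and \<sigma> :: "nat \<Rightarrow> complex measure"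
  assumes "star_system p a b \<sigma>"
  shows
    "(\<forall>n k l. k \<le> p - 1 \<and> l \<le> p \<and> [degree (mop p \<sigma> n) = l] (mod (p + 1)) \<longrightarrow>
        (\<exists>S \<subseteq> {a k<..<b k}. finite S \<and> card S \<ge> Z_count p n l k \<and>
           (\<forall>x\<in>S. odd_zero (reduced_second_kind p \<sigma> n l k) (complex_of_real x)))) \<and>
     (\<forall>n. degree (mop p \<sigma> n) = n) \<and>
     (\<forall>n l d. l \<le> p \<and> [degree (mop p \<sigma> n) = l] (mod (p + 1)) \<and>
           d = degree (mop p \<sigma> n) div (p + 1) \<longrightarrow>
        real d = (real n - real l) / (real p + 1) \<and>
        card {z. poly (reduced_mop p \<sigma> n l) z = 0} = d \<and>
        (\<forall>z. poly (reduced_mop p \<sigma> n l) z = 0 \<longrightarrow>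
           order z (reduced_mop p \<sigma> n l) = 1 \<and> z \<in> complex_of_real ` {a 0<..<b 0}))"
proof -
  interpret star_nikishin p a b \<sigma> by unfold_locales fact
  have index: "star_nikishin_index p a b \<sigma>" ..
  \<comment> \<open>The bound \<open>l \<le> p\<close> turns the congruence into equality with the
    remainder, so the \<open>l\<close> of the theorem is the one fixed in the locale.\<close>
  have l_eq: "star_nikishin_index.l p \<sigma> n = l" if "l \<le> p" "[degree (mop p \<sigma> n) = l] (mod (p + 1))" for n l
    using that star_nikishin_index.l_def[OF index] star_nikishin_index.Q_def[OF index]
    by (simp add: cong_def N_def)
  show ?thesis
  proof (intro conjI allI impI)
    fix n k l assume *: "k \<le> p - 1 \<and> l \<le> p \<and> [degree (mop p \<sigma> n) = l] (mod (p + 1))"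
    interpret I: star_nikishin_index p a b \<sigma> n ..
    have l: "I.l = l" using * l_eq by blast
    have k: "k < p" using * p_pos by linarith
    show "\<exists>S\<subseteq>{a k<..<b k}. finite S \<and> Z_count p n l k \<le> card S \<and>
      (\<forall>x\<in>S. odd_zero (reduced_second_kind p \<sigma> n l k) (complex_of_real x))"
      using I.finite_odd_zeros[OF k] I.Z_count_le_card_odd_zeros[OF k]
      by (intro exI[of _ "I.odd_zeros k"]) (auto simp: I.odd_zeros_def I.\<psi>_def l)
  next
    fix n
    interpret I: star_nikishin_index p a b \<sigma> n ..
    show "degree (mop p \<sigma> n) = n" using I.degree_Q_eq by (simp add: I.Q_def)
  next
    fix n l d
    assume *: "l \<le> p \<and> [degree (mop p \<sigma> n) = l] (mod (p + 1)) \<and> d = degree (mop p \<sigma> n) div (p + 1)"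
    interpret I: star_nikishin_index p a b \<sigma> n ..
    have l: "I.l = l" using * l_eq by blast
    have R: "reduced_mop p \<sigma> n l = I.R" by (simp add: I.R_def l)
    have n: "n = l + N * degree I.R" using I.degree_Q I.degree_Q_eq l by simp
    then have d: "d = degree I.R"
    proof -
      have "n div N = (l + N * degree I.R) div N" by (rule arg_cong[OF n])
      also have "\<dots> = degree I.R" using I.l_less l by simp
      finally have "n div N = degree I.R" .
      then show ?thesis using * I.degree_Q_eq by (simp add: I.Q_def N_def)
    qed
    show "real d = (real n - real l) / (real p + 1)"
    proof -
      have "real n = real l + (real p + 1) * real d"
        using arg_cong[OF n, of real] by (simp add: d N_def algebra_simps)
      then show ?thesis by simp
    qed
    show "card {z. poly (reduced_mop p \<sigma> n l) z = 0} = d"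
      unfolding R d by (rule I.roots_R)
    fix z assume z: "poly (reduced_mop p \<sigma> n l) z = 0"
    show "order z (reduced_mop p \<sigma> n l) = 1" using z I.order_R by (simp add: R)
    show "z \<in> complex_of_real ` {a 0<..<b 0}"
    proof -
      have "z \<in> complex_of_real ` I.odd_zeros 0" using z I.roots_R(1) by (auto simp: R)
      then show ?thesis by (auto simp: I.odd_zeros_def)
    qed
  qed
qed

end
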